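(* Let $p\in[1,+\infty]$, let $M$ be a proper subset of $L_p$, and let $Y$ be a Banach space containing uniformly the $\ell_p^n$'s. Then $M$ is almost Lipschitz embeddable into $Y$.
   Context: $L_p$ denotes the Lebesgue space $L_p([0,1])$ with its norm. A metric space is proper if all its closed balls are compact; a proper subset $M$ of $L_p$ means a subset which is a proper metric space for the metric induced by the norm. A Banach space $Y$ contains the $\ell_p^n$'s uniformly if there are $\lambda\in[1,\infty)$ and a sequence $(E_n)_{n=1}^\infty$ of subspaces of $Y$ such that, for each $n$, $E_n$ is linearly isomorphic to $\ell_p^n$ with Banach-Mazur distance $d_{BM}(E_n,\ell_p^n)\le\lambda$. A metric space $(X,d_X)$ is almost Lipschitz embeddable (almost Lipschitzly embeds) into a metric space $(Y,d_Y)$ if there exist a scaling factor $r\in(0,\infty)$ and a constant $D\in[1,\infty)$ such that for any continuous function $\varphi\colon[0,+\infty)\to[0,1)$ satisfying $\varphi(0)=0$ and $\varphi(t)>0$ for all $t>0$, there exists a map $f_\varphi\colon X\to Y$ such that for all $x,y\in X$, $$\varphi(d_X(x,y))\,r\,d_X(x,y)\le d_Y(f_\varphi(x),f_\varphi(y))\le D\,r\,d_X(x,y).$$ *)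

theory Defs
  imports "HOL-Analysis.Analysis" "HOL-Analysis.Finite_Function_Topology"
    "HOL-Probability.Essential_Supremum"
begin

abbreviation unit_lebesgue :: "real measure" where
  "unit_lebesgue \<equiv> lebesgue_on {0..1}"

definition Lp_functions :: "ennreal \<Rightarrow> (real \<Rightarrow> real) set" where
  "Lp_functions p = {f \<in> borel_measurable unit_lebesgue.
     if p = top then esssup unit_lebesgue (\<lambda>x. ereal \<bar>f x\<bar>) < \<infinity>
     else integrable unit_lebesgue (\<lambda>x. \<bar>f x\<bar> powr enn2real p)}"

definition Lp_norm :: "ennreal \<Rightarrow> (real \<Rightarrow> real) \<Rightarrow> real" where
  "Lp_norm p f =
     (if p = top then real_of_ereal (esssup unit_lebesgue (\<lambda>x. ereal \<bar>f x\<bar>))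
      else (\<integral>x. \<bar>f x\<bar> powr enn2real p \<partial>unit_lebesgue) powr (1 / enn2real p))"

definition Lp_class :: "ennreal \<Rightarrow> (real \<Rightarrow> real) \<Rightarrow> (real \<Rightarrow> real) set" where
  "Lp_class p f = {g \<in> Lp_functions p. AE x in unit_lebesgue. f x = g x}"

definition Lp_dist :: "ennreal \<Rightarrow> (real \<Rightarrow> real) set \<Rightarrow> (real \<Rightarrow> real) set \<Rightarrow> real" where
  "Lp_dist p F G = Lp_norm p (\<lambda>x. (SOME f. f \<in> F) x - (SOME g. g \<in> G) x)"

text \<open>
  Points are almost-everywhere equivalence classes (values outside \<open>[0,1]\<close> play no role), so that
  the norm induces a metric and not merely a pseudometric; the choice of representatives in
  \<open>Lp_dist\<close> is immaterial. Lemma \<open>Metric_space_Lp\<close> shows that \<open>metric\<close> is applied to a genuine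
  metric space whenever \<open>1 \<le> p\<close>.
\<close>

definition Lp_metric :: "ennreal \<Rightarrow> (real \<Rightarrow> real) set metric" where
  "Lp_metric p = metric (Lp_class p ` Lp_functions p, Lp_dist p)"

lemma unit_lebesgue_nonzero: "emeasure unit_lebesgue (space unit_lebesgue) \<noteq> 0"
  by (simp add: emeasure_restrict_space)

lemma convex_powr_real:
  fixes p t a b :: real
  assumes "1 \<le> p" "0 \<le> t" "t \<le> 1" "0 \<le> a" "0 \<le> b"
  shows "(t * a + (1 - t) * b) powr p \<le> t * a powr p + (1 - t) * b powr p"
proof -
  have pos: "(t * a + (1 - t) * b) powr p \<le> t * a powr p + (1 - t) * b powr p"
    if "0 < a" "0 < b" for a b
  proof -
    have "convex_on {0<..} (\<lambda>x::real. x powr p)"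
    proof (rule f''_ge0_imp_convex)
      show "DERIV (\<lambda>x::real. x powr p) x :> p * x powr (p - 1)" if "x \<in> {0<..}" for x
        using that by (intro has_real_derivative_powr) (auto)
      show "DERIV (\<lambda>x::real. p * x powr (p - 1)) x :> p * ((p - 1) * x powr (p - 1 - 1))"
        if "x \<in> {0<..}" for x
        using that by (intro DERIV_cmult has_real_derivative_powr) auto
    qed (use assms in auto)
    from convex_onD[OF this, of "1 - t" a b] show ?thesis
      using assms that by (simp add: algebra_simps)
  qed
  have z: "(s * c) powr p \<le> s * c powr p" if "0 \<le> s" "s \<le> 1" "0 \<le> c" for s c :: real
  proof (cases "s = 0")
    case False
    then have "s powr p \<le> s powr 1"
      using that assms by (intro powr_mono') auto
    then have "s powr p \<le> s" using that by simp
    then show ?thesis using that by (simp add: powr_mult mult_right_mono)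
  qed (use assms in simp)
  show ?thesis
    using pos[of a b] z[of t a] z[of "1 - t" b] assms
    by (cases "a = 0"; cases "b = 0") auto
qed

lemma finite_exponent:
  assumes "1 \<le> p" "p \<noteq> top"
  shows "1 \<le> enn2real p"
  using assms by (cases p) (auto simp: ennreal_ge_1)

lemma Lp_integrable_add:
  fixes f g :: "'a \<Rightarrow> real" and p a b :: real
  assumes p: "1 \<le> p" and m: "f \<in> borel_measurable M" "g \<in> borel_measurable M"
    and f: "integrable M (\<lambda>x. \<bar>f x\<bar> powr p)" and g: "integrable M (\<lambda>x. \<bar>g x\<bar> powr p)"
    and ab: "0 < a" "0 < b" "(\<integral>x. \<bar>f x\<bar> powr p \<partial>M) \<le> a powr p" "(\<integral>x. \<bar>g x\<bar> powr p \<partial>M) \<le> b powr p"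
  shows "integrable M (\<lambda>x. \<bar>f x + g x\<bar> powr p)"
    and "(\<integral>x. \<bar>f x + g x\<bar> powr p \<partial>M) \<le> (a + b) powr p"
proof -
  define t where "t = a / (a + b)"
  have t: "0 < t" "t < 1" "1 - t = b / (a + b)"
    using ab by (auto simp: t_def field_simps)
  define h where "h x = (a + b) powr p * (t * (\<bar>f x\<bar> powr p / a powr p) + (1 - t) * (\<bar>g x\<bar> powr p / b powr p))" for x
  have le: "\<bar>f x + g x\<bar> powr p \<le> h x" for x
  proof -
    have "\<bar>f x + g x\<bar> \<le> (a + b) * (t * (\<bar>f x\<bar> / a) + (1 - t) * (\<bar>g x\<bar> / b))"
    proof -
      have "(a + b) * (t * (\<bar>f x\<bar> / a)) = \<bar>f x\<bar>" "(a + b) * ((1 - t) * (\<bar>g x\<bar> / b)) = \<bar>g x\<bar>"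
        unfolding t(3) using ab by (simp_all add: t_def)
      then show ?thesis by (simp only: distrib_left)
    qed
    then have "\<bar>f x + g x\<bar> powr p \<le> ((a + b) * (t * (\<bar>f x\<bar> / a) + (1 - t) * (\<bar>g x\<bar> / b))) powr p"
      using p by (intro powr_mono2) auto
    also have "\<dots> = (a + b) powr p * (t * (\<bar>f x\<bar> / a) + (1 - t) * (\<bar>g x\<bar> / b)) powr p"
      by (rule powr_mult)
    also have "\<dots> \<le> (a + b) powr p * (t * (\<bar>f x\<bar> / a) powr p + (1 - t) * (\<bar>g x\<bar> / b) powr p)"
      using ab t p by (intro mult_left_mono convex_powr_real) auto
    also have "\<dots> = h x"
      using ab by (simp add: h_def powr_divide)
    finally show ?thesis .
  qed
  have h: "integrable M h"
    unfolding h_def using f g by auto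
  show i: "integrable M (\<lambda>x. \<bar>f x + g x\<bar> powr p)"
      proof (rule Bochner_Integration.integrable_bound[OF h])
    show "AE x in M. norm (\<bar>f x + g x\<bar> powr p) \<le> norm (h x)"
      by (intro AE_I2) (simp add: order_trans[OF le abs_ge_self])
  qed (use m in measurable)
  have "(\<integral>x. \<bar>f x + g x\<bar> powr p \<partial>M) \<le> (\<integral>x. h x \<partial>M)"
    by (rule integral_mono[OF i h le])
  also have "\<dots> = (a + b) powr p * (t * ((\<integral>x. \<bar>f x\<bar> powr p \<partial>M) / a powr p) + (1 - t) * ((\<integral>x. \<bar>g x\<bar> powr p \<partial>M) / b powr p))"
    unfolding h_def using f g by simp
  also have "\<dots> \<le> (a + b) powr p * (t * 1 + (1 - t) * 1)"
    using ab t by (intro mult_left_mono add_mono) auto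
  finally show "(\<integral>x. \<bar>f x + g x\<bar> powr p \<partial>M) \<le> (a + b) powr p" by simp
qed

lemma Lp_norm_nonneg: "0 \<le> Lp_norm p f"
proof -
  have "0 \<le> esssup unit_lebesgue (\<lambda>x. ereal \<bar>f x\<bar>)"
  proof -
    have "esssup unit_lebesgue (\<lambda>x. 0 :: ereal) \<le> esssup unit_lebesgue (\<lambda>x. ereal \<bar>f x\<bar>)"
      by (rule esssup_mono) auto
    then show ?thesis using esssup_const[OF unit_lebesgue_nonzero, of "0::ereal"] by simp
  qed
  then show ?thesis by (simp add: Lp_norm_def real_of_ereal_pos)
qed

lemma Lp_norm_top_bound:
  assumes "f \<in> Lp_functions top"
  shows "AE x in unit_lebesgue. \<bar>f x\<bar> \<le> Lp_norm top f"
proof -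
  let ?e = "esssup unit_lebesgue (\<lambda>x. ereal \<bar>f x\<bar>)"
  have ae: "AE x in unit_lebesgue. ereal \<bar>f x\<bar> \<le> ?e" by (rule esssup_AE)
  have "esssup unit_lebesgue (\<lambda>x. 0 :: ereal) \<le> ?e"
    by (rule esssup_mono) (use assms in \<open>auto simp: Lp_functions_def\<close>)
  then have "0 \<le> ?e" using esssup_const[OF unit_lebesgue_nonzero, of "0::ereal"] by simp
  moreover have "?e < \<infinity>" using assms by (simp add: Lp_functions_def)
  ultimately have "?e = ereal (Lp_norm top f)" by (cases ?e) (auto simp: Lp_norm_def)
  with ae show ?thesis by simp
qed

lemma Lp_norm_top_leI:
  assumes "f \<in> borel_measurable unit_lebesgue" "AE x in unit_lebesgue. \<bar>f x\<bar> \<le> c"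
  shows "f \<in> Lp_functions top" "Lp_norm top f \<le> c"
proof -
  let ?e = "esssup unit_lebesgue (\<lambda>x. ereal \<bar>f x\<bar>)"
  have le: "?e \<le> ereal c"
    by (rule esssup_I) (use assms in auto)
  then show "f \<in> Lp_functions top" using assms by (auto simp: Lp_functions_def)
  have "esssup unit_lebesgue (\<lambda>x. 0 :: ereal) \<le> ?e"
    by (rule esssup_mono) (use assms in auto)
  then have "0 \<le> ?e" using esssup_const[OF unit_lebesgue_nonzero, of "0::ereal"] by simp
  with le show "Lp_norm top f \<le> c" by (cases ?e) (auto simp: Lp_norm_def)
qed

lemma Lp_norm_powr:
  assumes "1 \<le> p" "p \<noteq> top"
  shows "(\<integral>x. \<bar>f x\<bar> powr enn2real p \<partial>unit_lebesgue) = Lp_norm p f powr enn2real p"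
proof -
  have "0 \<le> (\<integral>x. \<bar>f x\<bar> powr enn2real p \<partial>unit_lebesgue)" by simp
  then show ?thesis
    using finite_exponent[OF assms] assms by (simp add: Lp_norm_def powr_powr)
qed

lemma Lp_add:
  assumes p: "1 \<le> p" and f: "f \<in> Lp_functions p" and g: "g \<in> Lp_functions p"
  shows "(\<lambda>x. f x + g x) \<in> Lp_functions p"
    and "Lp_norm p (\<lambda>x. f x + g x) \<le> Lp_norm p f + Lp_norm p g"
proof -
  have m: "f \<in> borel_measurable unit_lebesgue" "g \<in> borel_measurable unit_lebesgue"
    using f g by (auto simp: Lp_functions_def)
  have "(\<lambda>x. f x + g x) \<in> Lp_functions p \<and> Lp_norm p (\<lambda>x. f x + g x) \<le> Lp_norm p f + Lp_norm p g"
  proof (cases "p = top")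
    case True
    have "AE x in unit_lebesgue. \<bar>f x + g x\<bar> \<le> Lp_norm top f + Lp_norm top g"
      using Lp_norm_top_bound[OF f[unfolded True]] Lp_norm_top_bound[OF g[unfolded True]]
      by eventually_elim linarith
    then show ?thesis
      using Lp_norm_top_leI[of "\<lambda>x. f x + g x"] m True by auto
  next
    case False
    let ?q = "enn2real p"
    have q: "1 \<le> ?q" using finite_exponent p False by blast
    have i: "integrable unit_lebesgue (\<lambda>x. \<bar>f x\<bar> powr ?q)" "integrable unit_lebesgue (\<lambda>x. \<bar>g x\<bar> powr ?q)"
      using f g False by (auto simp: Lp_functions_def)
    have *: "integrable unit_lebesgue (\<lambda>x. \<bar>f x + g x\<bar> powr ?q)"
      "(\<integral>x. \<bar>f x + g x\<bar> powr ?q \<partial>unit_lebesgue) \<le> (Lp_norm p f + e + (Lp_norm p g + e)) powr ?q"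
      if "0 < e" for e
    proof -
      have n: "0 < Lp_norm p f + e" "0 < Lp_norm p g + e"
        using that Lp_norm_nonneg[of p f] Lp_norm_nonneg[of p g] by linarith+
      have le: "(\<integral>x. \<bar>h x\<bar> powr ?q \<partial>unit_lebesgue) \<le> (Lp_norm p h + e) powr ?q" for h
        using that q Lp_norm_nonneg[of p h]
        by (simp add: Lp_norm_powr[OF p False] powr_mono2)
      show "integrable unit_lebesgue (\<lambda>x. \<bar>f x + g x\<bar> powr ?q)"
        "(\<integral>x. \<bar>f x + g x\<bar> powr ?q \<partial>unit_lebesgue) \<le> (Lp_norm p f + e + (Lp_norm p g + e)) powr ?q"
        by (fact Lp_integrable_add[OF q m i n le le])+
    qed
    have "Lp_norm p (\<lambda>x. f x + g x) \<le> Lp_norm p f + Lp_norm p g + e" if "0 < e" for e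
    proof -
      have "Lp_norm p (\<lambda>x. f x + g x) powr ?q \<le> (Lp_norm p f + Lp_norm p g + e) powr ?q"
        using *(2)[of "e / 2"] that by (simp add: Lp_norm_powr[OF p False] algebra_simps)
      moreover have "0 \<le> Lp_norm p f + Lp_norm p g + e"
        using that Lp_norm_nonneg[of p f] Lp_norm_nonneg[of p g] by linarith
      ultimately show ?thesis
        using q powr_less_mono2[of ?q "Lp_norm p f + Lp_norm p g + e" "Lp_norm p (\<lambda>x. f x + g x)"]
        by linarith
    qed
    then have "Lp_norm p (\<lambda>x. f x + g x) \<le> Lp_norm p f + Lp_norm p g"
      by (rule field_le_epsilon)
    then show ?thesis using *(1)[of 1] m False by (auto simp: Lp_functions_def)
  qed
  then show "(\<lambda>x. f x + g x) \<in> Lp_functions p"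
    "Lp_norm p (\<lambda>x. f x + g x) \<le> Lp_norm p f + Lp_norm p g" by auto
qed

lemma Lp_uminus:
  "(\<lambda>x. - f x) \<in> Lp_functions p \<longleftrightarrow> f \<in> Lp_functions p"
  "Lp_norm p (\<lambda>x. - f x) = Lp_norm p f"
  by (auto simp: Lp_functions_def Lp_norm_def)

lemma Lp_diff:
  assumes "1 \<le> p" "f \<in> Lp_functions p" "g \<in> Lp_functions p"
  shows "(\<lambda>x. f x - g x) \<in> Lp_functions p"
  using Lp_add(1)[of p f "\<lambda>x. - g x"] assms by (simp add: Lp_uminus)

lemma Lp_norm_eq_0_iff:
  assumes p: "1 \<le> p" and f: "f \<in> Lp_functions p"
  shows "Lp_norm p f = 0 \<longleftrightarrow> (AE x in unit_lebesgue. f x = 0)"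
proof (cases "p = top")
  case True
  show ?thesis
  proof
    assume "Lp_norm p f = 0"
    then show "AE x in unit_lebesgue. f x = 0"
      using Lp_norm_top_bound[of f] f True by auto
  next
    assume "AE x in unit_lebesgue. f x = 0"
    then have "Lp_norm top f \<le> 0"
      using f by (intro Lp_norm_top_leI) (auto simp: Lp_functions_def)
    then show "Lp_norm p f = 0" using Lp_norm_nonneg[of p f] True by simp
  qed
next
  case False
  then have "integrable unit_lebesgue (\<lambda>x. \<bar>f x\<bar> powr enn2real p)"
    using f by (simp add: Lp_functions_def)
  from integral_nonneg_eq_0_iff_AE[OF this] show ?thesis
    using False by (simp add: Lp_norm_def)
qed

lemma Metric_space_Lp:
  assumes p: "1 \<le> p"
  shows "Metric_space (Lp_class p ` Lp_functions p) (Lp_dist p)"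
proof -
  define r :: "(real \<Rightarrow> real) set \<Rightarrow> real \<Rightarrow> real" where "r F = (SOME f. f \<in> F)" for F
  have d: "Lp_dist p F G = Lp_norm p (\<lambda>x. r F x - r G x)" for F G
    by (simp add: Lp_dist_def r_def)
  have r: "r F \<in> Lp_functions p \<and> F = Lp_class p (r F)" if "F \<in> Lp_class p ` Lp_functions p" for F
  proof -
    from that obtain f where f: "f \<in> Lp_functions p" "F = Lp_class p f" by blast
    then have "f \<in> F" by (simp add: Lp_class_def)
    then have "r F \<in> F" unfolding r_def by (rule someI[of "\<lambda>f. f \<in> F"])
    then have *: "r F \<in> Lp_functions p" "AE x in unit_lebesgue. f x = r F x"
      using f by (auto simp: Lp_class_def)
    have "(AE x in unit_lebesgue. f x = g x) \<longleftrightarrow> (AE x in unit_lebesgue. r F x = g x)" for g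
      using *(2) by (intro eventually_subst) (auto elim: eventually_mono)
    then have "Lp_class p f = Lp_class p (r F)"
      unfolding Lp_class_def by (intro Collect_cong conj_cong refl)
    with *(1) f(2) show ?thesis by argo
  qed
  have rL: "r F \<in> Lp_functions p" if "F \<in> Lp_class p ` Lp_functions p" for F
    by (rule conjunct1[OF r[OF that]])
  show ?thesis
  proof
    show "0 \<le> Lp_dist p F G" for F G by (simp add: d Lp_norm_nonneg)
    show "Lp_dist p F G = Lp_dist p G F" for F G
      unfolding d using Lp_uminus(2)[of p "\<lambda>x. r G x - r F x"] by simp
    show "Lp_dist p F G = 0 \<longleftrightarrow> F = G"
      if "F \<in> Lp_class p ` Lp_functions p" "G \<in> Lp_class p ` Lp_functions p" for F G
    proof -
      have "Lp_dist p F G = 0 \<longleftrightarrow> (AE x in unit_lebesgue. r F x = r G x)"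
        using Lp_norm_eq_0_iff[OF p Lp_diff[OF p rL[OF that(1)] rL[OF that(2)]]] by (simp add: d)
      also have "\<dots> \<longleftrightarrow> F = G"
      proof
        assume ae: "AE x in unit_lebesgue. r F x = r G x"
        have "(AE x in unit_lebesgue. r F x = g x) \<longleftrightarrow> (AE x in unit_lebesgue. r G x = g x)" for g
          using ae by (intro eventually_subst) (auto elim: eventually_mono)
        then have "Lp_class p (r F) = Lp_class p (r G)"
          unfolding Lp_class_def by (intro Collect_cong conj_cong refl)
        then show "F = G"
          using conjunct2[OF r[OF that(1)]] conjunct2[OF r[OF that(2)]] by argo
      qed simp
      finally show ?thesis .
    qed
    show "Lp_dist p F H \<le> Lp_dist p F G + Lp_dist p G H"
      if "F \<in> Lp_class p ` Lp_functions p" "G \<in> Lp_class p ` Lp_functions p"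
        "H \<in> Lp_class p ` Lp_functions p" for F G H
      using Lp_add(2)[OF p Lp_diff[OF p rL[OF that(1)] rL[OF that(2)]] Lp_diff[OF p rL[OF that(2)] rL[OF that(3)]]]
      by (simp add: d)
  qed
qed

lemma mspace_Lp: "1 \<le> p \<Longrightarrow> mspace (Lp_metric p) = Lp_class p ` Lp_functions p"
  and mdist_Lp: "1 \<le> p \<Longrightarrow> mdist (Lp_metric p) = Lp_dist p"
  by (simp_all add: Lp_metric_def Metric_space.mspace_metric Metric_space.mdist_metric Metric_space_Lp)

definition proper_metric :: "'a metric \<Rightarrow> bool" where
  "proper_metric X \<longleftrightarrow> (\<forall>x \<in> mspace X. \<forall>r. compactin (mtopology_of X) (mcball_of X x r))"

text \<open>
  In the following definitions a normed space is given by a subspace \<open>E\<close> of a real vector space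
  and a function \<open>N\<close> that is a norm on \<open>E\<close> (not necessarily the type class norm, which on
  \<open>nat \<Rightarrow>\<^sub>0 real\<close> is unrelated to the \<open>p\<close>-norm).
\<close>

definition linear_iso_on :: "'a::real_vector set \<Rightarrow> 'b::real_vector set \<Rightarrow> ('a \<Rightarrow> 'b) \<Rightarrow> bool" where
  "linear_iso_on E F T \<longleftrightarrow> bij_betw T E F \<and>
     (\<forall>x\<in>E. \<forall>y\<in>E. T (x + y) = T x + T y) \<and> (\<forall>c. \<forall>x\<in>E. T (c *\<^sub>R x) = c *\<^sub>R T x)"

definition op_norm_on :: "'a set \<Rightarrow> ('a \<Rightarrow> real) \<Rightarrow> ('b \<Rightarrow> real) \<Rightarrow> ('a \<Rightarrow> 'b) \<Rightarrow> ennreal" where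
  "op_norm_on E N N' T = (SUP x \<in> {x \<in> E. N x \<le> 1}. ennreal (N' (T x)))"

text \<open>The value is \<open>\<infinity>\<close> if the two spaces are not isomorphic.\<close>

definition Banach_Mazur_dist ::
  "'a::real_vector set \<Rightarrow> ('a \<Rightarrow> real) \<Rightarrow> 'b::real_vector set \<Rightarrow> ('b \<Rightarrow> real) \<Rightarrow> ennreal" where
  "Banach_Mazur_dist E N F N' =
     (INF T \<in> {T. linear_iso_on E F T}. op_norm_on E N N' T * op_norm_on F N' N (inv_into E T))"

text \<open>Coordinates of \<open>\<ell>\<^sub>p\<^sup>n\<close> are indexed by \<open>0,\<dots>,n - 1\<close>; \<open>lp_norm\<close> is only meant for \<open>n \<ge> 1\<close>.\<close>

definition lp_space :: "nat \<Rightarrow> (nat \<Rightarrow>\<^sub>0 real) set" where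
  "lp_space n = {x. Poly_Mapping.keys x \<subseteq> {..<n}}"

definition lp_norm :: "ennreal \<Rightarrow> nat \<Rightarrow> (nat \<Rightarrow>\<^sub>0 real) \<Rightarrow> real" where
  "lp_norm p n x =
     (if p = top then Max ((\<lambda>i. \<bar>Poly_Mapping.lookup x i\<bar>) ` {..<n})
      else (\<Sum>i<n. \<bar>Poly_Mapping.lookup x i\<bar> powr enn2real p) powr (1 / enn2real p))"

definition contains_lp_uniformly :: "ennreal \<Rightarrow> 'b::real_normed_vector set \<Rightarrow> bool" where
  "contains_lp_uniformly p Y \<longleftrightarrow>
     (\<exists>C \<ge> (1::real). \<exists>E :: nat \<Rightarrow> 'b set. \<forall>n \<ge> 1.
        subspace (E n) \<and> E n \<subseteq> Y \<and>
        (\<exists>T. linear_iso_on (E n) (lp_space n) T) \<and>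
        Banach_Mazur_dist (E n) norm (lp_space n) (lp_norm p n) \<le> ennreal C)"

definition almost_Lipschitz_embeddable :: "'a metric \<Rightarrow> 'b metric \<Rightarrow> bool" where
  "almost_Lipschitz_embeddable X Y \<longleftrightarrow>
     (\<exists>r > 0. \<exists>D \<ge> 1. \<forall>\<phi> :: real \<Rightarrow> real.
        continuous_on {0..} \<phi> \<and> \<phi> ` {0..} \<subseteq> {0..<1} \<and> \<phi> 0 = 0 \<and> (\<forall>t>0. 0 < \<phi> t) \<longrightarrow>
        (\<exists>f. f ` mspace X \<subseteq> mspace Y \<and>
          (\<forall>x \<in> mspace X. \<forall>y \<in> mspace X.
             \<phi> (mdist X x y) * r * mdist X x y \<le> mdist Y (f x) (f y) \<and>
             mdist Y (f x) (f y) \<le> D * r * mdist X x y)))"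

end

theory Submission
  imports Defs
begin

text \<open>
  Averaging over the fibres of a suitable simple function is a linear contraction from \<open>L\<^sub>p\<close> onto an
  isometric copy of some \<open>\<ell>\<^sub>p\<^sup>m\<close> that moves the points of a given totally bounded set arbitrarily
  little. By Mazur's technique the copies of the \<open>\<ell>\<^sub>p\<^sup>m\<close> in \<open>Y\<close> can be chosen successively so that
  every summand of a finite sum of vectors from these copies has norm at most four times the norm
  of the sum. After moving a point of \<open>M\<close> to the origin, put
  \<open>f x = (\<Sum>n j. 2\<^sup>-\<^sup>j R\<^sub>n\<^sub>j (\<lambda>\<^sub>n(\<parallel>x\<parallel>) S\<^sub>n\<^sub>j x))\<close>, where \<open>(\<lambda>\<^sub>n)\<close> is a dyadic partition of unity on the
  half-line, \<open>S\<^sub>n\<^sub>j\<close> is such a contraction that is accurate up to \<open>\<tau>\<^sub>j\<close> on the ball of radius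
  \<open>2\<^sup>n\<^sup>+\<^sup>1\<close>, and \<open>R\<^sub>n\<^sub>j\<close> is the embedding of its range into \<open>Y\<close>. The vectors
  \<open>\<lambda>\<^sub>n(\<parallel>x\<parallel>) x - \<lambda>\<^sub>n(\<parallel>y\<parallel>) y\<close> add up to \<open>x - y\<close> and at most four of them do not vanish, so one of them
  is large; the component \<open>(n, j)\<close> then bounds \<open>\<parallel>f x - f y\<parallel>\<close> from below by a constant times
  \<open>2\<^sup>-\<^sup>j \<parallel>x - y\<parallel>\<close> as soon as \<open>\<tau>\<^sub>j \<le> \<parallel>x - y\<parallel>\<close>. Choosing \<open>\<tau>\<^sub>j\<close> such that \<open>\<phi> \<le> 2\<^sup>-\<^sup>j\<^sup>-\<^sup>1\<close> on
  \<open>[0, \<tau>\<^sub>j]\<close> gives the lower estimate for every \<open>\<phi>\<close> with constants independent of \<open>\<phi>\<close>.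
\<close>

subsection \<open>Tuples with the p-norm\<close>

text \<open>The \<open>p\<close>-norm of the first \<open>n\<close> terms of an arbitrary sequence,
  so that coefficient families need not be packed as finitely supported functions.\<close>

definition ell_norm :: "ennreal \<Rightarrow> nat \<Rightarrow> (nat \<Rightarrow> real) \<Rightarrow> real" where
  "ell_norm p n v =
     (if p = top then Max ((\<lambda>i. \<bar>v i\<bar>) ` {..<n})
      else (\<Sum>i<n. \<bar>v i\<bar> powr enn2real p) powr (1 / enn2real p))"

lemma ell_norm_cong: "(\<And>i. i < n \<Longrightarrow> v i = w i) \<Longrightarrow> ell_norm p n v = ell_norm p n w"
  unfolding ell_norm_def by (auto intro!: arg_cong[where f = Max] image_cong sum.cong)

lemma ell_norm_top_le_iff: "1 \<le> n \<Longrightarrow> ell_norm top n v \<le> c \<longleftrightarrow> (\<forall>i<n. \<bar>v i\<bar> \<le> c)"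
  unfolding ell_norm_def by (auto simp: Max_le_iff lessThan_empty_iff)

lemma coord_le_ell_norm:
  assumes "1 \<le> p" "i < n"
  shows "\<bar>v i\<bar> \<le> ell_norm p n v"
proof (cases "p = top")
  case True
  then show ?thesis using ell_norm_top_le_iff[of n v "ell_norm top n v"] assms by auto
next
  case False
  let ?q = "enn2real p"
  have q: "1 \<le> ?q" using finite_exponent assms False by blast
  have "\<bar>v i\<bar> = (\<bar>v i\<bar> powr ?q) powr (1 / ?q)" using q by (simp add: powr_powr)
  also have "\<dots> \<le> (\<Sum>i<n. \<bar>v i\<bar> powr ?q) powr (1 / ?q)"
    using q assms by (intro powr_mono2) (auto intro!: member_le_sum)
  finally show ?thesis using False by (simp add: ell_norm_def)
qed

lemma ell_norm_nonneg: "1 \<le> p \<Longrightarrow> 1 \<le> n \<Longrightarrow> 0 \<le> ell_norm p n v"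
  using coord_le_ell_norm[of p 0 n v] by linarith

lemma ell_norm_scale:
  assumes "1 \<le> p" "1 \<le> n"
  shows "ell_norm p n (\<lambda>i. c * v i) = \<bar>c\<bar> * ell_norm p n v"
proof (cases "p = top")
  case True
  have "Max ((\<lambda>x. \<bar>c\<bar> * x) ` (\<lambda>i. \<bar>v i\<bar>) ` {..<n}) = \<bar>c\<bar> * Max ((\<lambda>i. \<bar>v i\<bar>) ` {..<n})"
    using assms
    by (intro mono_Max_commute[symmetric] monoI mult_left_mono) (auto simp: lessThan_empty_iff)
  then show ?thesis using True by (simp add: ell_norm_def image_image abs_mult)
next
  case False
  have q: "1 \<le> enn2real p" using finite_exponent assms False by blast
  show ?thesis
    using q False
    by (simp add: ell_norm_def abs_mult powr_mult sum_distrib_left[symmetric] powr_powr sum_nonneg)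
qed

lemma sum_lessThan_double: "(\<Sum>j<2 * n. f j) = (\<Sum>i<n. f (2 * i) + f (Suc (2 * i)))"
  for f :: "nat \<Rightarrow> 'a::comm_monoid_add"
  by (induction n) (simp_all add: add.assoc)

text \<open>Spreading coordinate \<open>i\<close> over a block of two along the unit vector
  \<open>w i\<close> is isometric, because the \<open>p\<close>-norm of \<open>2 * n\<close>
  coordinates is the \<open>p\<close>-norm of the \<open>n\<close> block norms.\<close>

lemma ell_norm_double:
  assumes p: "1 \<le> p" and n: "1 \<le> n" and w: "\<And>i. i < n \<Longrightarrow> ell_norm p 2 (w i) = 1"
  shows "ell_norm p (2 * n) (\<lambda>j. v (j div 2) * w (j div 2) (j mod 2)) = ell_norm p n v"
proof (cases "p = top")
  case True
  have le1: "\<bar>w i b\<bar> \<le> 1" if "i < n" "b < 2" for i b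
    using w[OF that(1)] coord_le_ell_norm[OF p that(2), of "w i"] by simp
  have ex1: "\<exists>b<2. \<bar>w i b\<bar> = 1" if "i < n" for i
  proof -
    have "Max ((\<lambda>b. \<bar>w i b\<bar>) ` {..<2}) \<in> (\<lambda>b. \<bar>w i b\<bar>) ` {..<2}"
      by (rule Max_in) (auto simp: lessThan_empty_iff)
    then show ?thesis using w[OF that] True by (auto simp: ell_norm_def)
  qed
  show ?thesis unfolding True
  proof (rule antisym)
    have "\<bar>v (j div 2) * w (j div 2) (j mod 2)\<bar> \<le> ell_norm top n v" if "j < 2 * n" for j
    proof -
      have j: "j div 2 < n" using that by auto
      have "\<bar>v (j div 2) * w (j div 2) (j mod 2)\<bar> \<le> \<bar>v (j div 2)\<bar> * 1"
        unfolding abs_mult using le1[OF j, of "j mod 2"] by (intro mult_left_mono) auto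
      also have "\<dots> \<le> ell_norm top n v" using coord_le_ell_norm[of top, OF _ j] by simp
      finally show ?thesis .
    qed
    then show "ell_norm top (2 * n) (\<lambda>j. v (j div 2) * w (j div 2) (j mod 2)) \<le> ell_norm top n v"
      using n by (subst ell_norm_top_le_iff) auto
    have "\<bar>v i\<bar> \<le> ell_norm top (2 * n) (\<lambda>j. v (j div 2) * w (j div 2) (j mod 2))" if "i < n" for i
    proof -
      from ex1[OF that] obtain b where b: "b < 2" "\<bar>w i b\<bar> = 1" by blast
      have "\<bar>v i\<bar> = \<bar>v ((2 * i + b) div 2) * w ((2 * i + b) div 2) ((2 * i + b) mod 2)\<bar>"
        using b by (simp add: abs_mult)
      also have "\<dots> \<le> ell_norm top (2 * n) (\<lambda>j. v (j div 2) * w (j div 2) (j mod 2))"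
        using b that by (intro coord_le_ell_norm[of top "2 * i + b" "2 * n"]) auto
      finally show ?thesis .
    qed
    then show "ell_norm top n v \<le> ell_norm top (2 * n) (\<lambda>j. v (j div 2) * w (j div 2) (j mod 2))"
      using n by (subst ell_norm_top_le_iff) auto
  qed
next
  case False
  let ?q = "enn2real p"
  have q: "1 \<le> ?q" using finite_exponent p False by blast
  have w1: "\<bar>w i 0\<bar> powr ?q + \<bar>w i 1\<bar> powr ?q = 1" if "i < n" for i
  proof -
    have *: "(\<bar>w i 0\<bar> powr ?q + \<bar>w i 1\<bar> powr ?q) powr (1 / ?q) = 1"
      using w[OF that] False by (simp add: ell_norm_def numeral_2_eq_2)
    have "\<bar>w i 0\<bar> powr ?q + \<bar>w i 1\<bar> powr ?q
        = ((\<bar>w i 0\<bar> powr ?q + \<bar>w i 1\<bar> powr ?q) powr (1 / ?q)) powr ?q"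
      using q by (simp add: powr_powr)
    then show ?thesis using * by simp
  qed
  have "\<bar>v i\<bar> powr ?q * \<bar>w i 0\<bar> powr ?q + \<bar>v i\<bar> powr ?q * \<bar>w i (Suc 0)\<bar> powr ?q = \<bar>v i\<bar> powr ?q"
    if "i < n" for i
    using w1[OF that] by (simp flip: distrib_left)
  then show ?thesis
    using False by (simp add: ell_norm_def sum_lessThan_double abs_mult powr_mult)
qed

subsection \<open>Finite-dimensional subspaces of normed spaces\<close>

text \<open>Induction on the spanning set: a new vector \<open>a\<close> outside
  \<open>span B\<close> keeps a positive distance from it, so in a bounded part of the larger span
  the coefficient of \<open>a\<close> and the remainder both stay bounded, and the set is a closed
  part of a sum of two compact sets.\<close>

lemma compact_span_Int_cball:
  fixes B :: "'b::real_normed_vector set"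
  assumes "finite B"
  shows "compact (span B \<inter> cball 0 r)"
  using assms
proof (induction B arbitrary: r rule: finite_induct)
  case empty
  have "finite (span ({} :: 'b set) \<inter> cball 0 r)" by simp
  then show ?case by (rule finite_imp_compact)
next
  case (insert a B)
  show ?case
  proof (cases "a \<in> span B")
    case True
    then show ?thesis using insert.IH by (simp add: span_redundant)
  next
    case False
    \<comment> \<open>Minimising over radius \<open>2 * norm a\<close> suffices: farther out
      \<open>norm (a + u)\<close> exceeds \<open>norm a\<close>, the value at
      \<open>u = 0\<close>.\<close>
    obtain u0 where u0: "u0 \<in> span B" and min: "\<And>u. u \<in> span B \<inter> cball 0 (2 * norm a) \<Longrightarrow> norm (a + u0) \<le> norm (a + u)"
    proof -
      have "\<exists>x \<in> span B \<inter> cball 0 (2 * norm a). \<forall>y \<in> span B \<inter> cball 0 (2 * norm a). norm (a + x) \<le> norm (a + y)"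
        by (intro continuous_attains_inf insert.IH continuous_intros) (auto simp: ex_in_conv[symmetric] intro!: exI[of _ 0] span_zero)
      then show ?thesis using that by blast
    qed
    define d where "d = norm (a + u0)"
    have d: "0 < d"
    proof -
      have "a \<noteq> - u0" using False u0 span_neg by metis
      then show ?thesis by (simp add: d_def add_eq_0_iff2)
    qed
    have dle: "d \<le> norm (a + u)" if "u \<in> span B" for u
    proof (cases "norm u \<le> 2 * norm a")
      case True
      then show ?thesis using min that by (simp add: d_def)
    next
      case False
      have "d \<le> norm a" using min[of 0] by (simp add: d_def span_zero)
      also have "\<dots> \<le> norm (a + u)" using False norm_triangle_ineq2[of u "- a"] by (simp add: add.commute)
      finally show ?thesis .
    qed
    have td: "\<bar>t\<bar> * d \<le> norm (u + t *\<^sub>R a)" if "u \<in> span B" for u t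
    proof (cases "t = 0")
      case False
      have "\<bar>t\<bar> * d \<le> \<bar>t\<bar> * norm (a + (1 / t) *\<^sub>R u)"
        using that by (intro mult_left_mono dle span_scale) auto
      also have "\<dots> = norm (t *\<^sub>R (a + (1 / t) *\<^sub>R u))" by simp
      also have "\<dots> = norm (u + t *\<^sub>R a)" using False by (simp add: algebra_simps)
      finally show ?thesis .
    qed simp
    \<comment> \<open>The radii come from \<open>td\<close>: the coefficient of \<open>a\<close> is
      at most \<open>r / d\<close>, hence the remainder has norm at most
      \<open>r + r / d * norm a\<close>.\<close>
    let ?S = "{x + y |x y. x \<in> span B \<inter> cball 0 (r + r / d * norm a) \<and> y \<in> (\<lambda>t. t *\<^sub>R a) ` cball 0 (r / d)}"
    have "span (insert a B) \<inter> cball 0 r = ?S \<inter> cball 0 r"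
    proof (intro equalityI subsetI)
      fix x assume x: "x \<in> span (insert a B) \<inter> cball 0 r"
      then obtain t where t: "x - t *\<^sub>R a \<in> span B" by (auto simp: span_insert)
      have xr: "norm x \<le> r" using x by simp
      have "\<bar>t\<bar> * d \<le> r" using td[OF t, of t] xr by simp
      then have tr: "\<bar>t\<bar> \<le> r / d" using d by (simp add: field_simps)
      have "norm (x - t *\<^sub>R a) \<le> norm x + \<bar>t\<bar> * norm a" using norm_triangle_ineq4[of x "t *\<^sub>R a"] by simp
      also have "\<dots> \<le> r + r / d * norm a" using xr tr by (intro add_mono mult_right_mono) auto
      finally have "x - t *\<^sub>R a \<in> span B \<inter> cball 0 (r + r / d * norm a)" using t by simp
      moreover have "t *\<^sub>R a \<in> (\<lambda>t. t *\<^sub>R a) ` cball 0 (r / d)" using tr by (intro imageI) simp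
      moreover have "x = (x - t *\<^sub>R a) + t *\<^sub>R a" by simp
      ultimately show "x \<in> ?S \<inter> cball 0 r" using x by blast
    next
      fix x assume "x \<in> ?S \<inter> cball 0 r"
      then show "x \<in> span (insert a B) \<inter> cball 0 r"
        by (auto intro!: span_add span_scale simp: span_base) (metis insert_subset span_mono subset_iff subset_insertI)
    qed
    moreover have "compact (?S \<inter> cball 0 r)"
      by (intro compact_Int_closed compact_sums insert.IH compact_continuous_image continuous_intros) auto
    ultimately show ?thesis by simp
  qed
qed

text \<open>Hahn-Banach for finitely generated subspaces, adding one generator at a time. The
  functional is linear on the whole space, while the bound by the norm is kept on the span; applied
  to \<open>- y\<close> it also bounds the absolute value.\<close>

lemma norming_functional_on_span:
  fixes u :: "'b::real_normed_vector"
  assumes "finite B"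
  shows "\<exists>\<psi>::'b \<Rightarrow> real. linear \<psi> \<and> (\<forall>y \<in> span (insert u B). \<psi> y \<le> norm y) \<and> \<psi> u = norm u"
  using assms
proof (induction B rule: finite_induct)
  case empty
  show ?case
  proof (cases "u = 0")
    case True
    then show ?thesis by (intro exI[of _ "\<lambda>_. 0"]) (auto simp: linear_zero)
  next
    case False
    then have "independent {u}" by simp
    from linear_independent_extend[OF this, of "\<lambda>_. norm u"] obtain g :: "'b \<Rightarrow> real"
      where g: "linear g" "g u = norm u" by auto
    have "g y \<le> norm y" if "y \<in> span {u}" for y
    proof -
      from that obtain k where "y = k *\<^sub>R u" by (auto simp: span_singleton)
      then show ?thesis using g by (simp add: linear_scale mult_right_mono)
    qed
    then show ?thesis using g by auto
  qed
next
  case (insert a B)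
  then obtain \<psi> :: "'b \<Rightarrow> real" where \<psi>: "linear \<psi>" "\<And>y. y \<in> span (insert u B) \<Longrightarrow> \<psi> y \<le> norm y" "\<psi> u = norm u"
    by blast
  let ?F = "span (insert u B)"
  show ?case
  proof (cases "a \<in> ?F")
    case True
    then have "span (insert u (insert a B)) = ?F" by (simp add: insert_commute span_redundant)
    then show ?thesis using \<psi> by (intro exI[of _ \<psi>]) auto
  next
    case False
    \<comment> \<open>A basis of the old span together with \<open>a\<close> yields a coordinate
      functional \<open>\<pi>\<close> that vanishes on the old span and is one at
      \<open>a\<close>.\<close>
    obtain C where C: "C \<subseteq> ?F" "independent C" "?F \<subseteq> span C" using maximal_independent_subset by blast
    then have CF: "span C = ?F" by (meson antisym span_minimal subspace_span)
    then have "independent (insert a C)" using False C by (simp add: independent_insertI)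
    from linear_independent_extend[OF this, of "\<lambda>x. if x = a then 1 else 0"] obtain \<pi> :: "'b \<Rightarrow> real"
      where \<pi>: "linear \<pi>" "\<forall>x \<in> insert a C. \<pi> x = (if x = a then 1 else 0)" by blast
    have "a \<notin> C" using C False by blast
    then have "\<And>x. x \<in> C \<Longrightarrow> \<pi> x = 0" using \<pi> by auto
    then have \<pi>F: "\<pi> x = 0" if "x \<in> ?F" for x
      using linear_eq_0_on_span[OF \<pi>(1), of C x] that CF by auto
    \<comment> \<open>Every lower constraint on the value at \<open>a\<close> lies below every upper
      one, so the supremum \<open>c\<close> of the lower ones is admissible.\<close>
    have key: "\<psi> x - norm (x - a) \<le> norm (y + a) - \<psi> y" if "x \<in> ?F" "y \<in> ?F" for x y
    proof -
      have "\<psi> x + \<psi> y = \<psi> (x + y)" using \<psi>(1) by (simp add: linear_add)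
      also have "\<dots> \<le> norm (x + y)" using that by (intro \<psi> span_add)
      also have "\<dots> \<le> norm (x - a) + norm (y + a)" using norm_triangle_ineq[of "x - a" "y + a"] by simp
      finally show ?thesis by simp
    qed
    have F0: "0 \<in> ?F" by (rule span_zero)
    define c where "c = (SUP x\<in>?F. \<psi> x - norm (x - a))"
    have bdd: "bdd_above ((\<lambda>x. \<psi> x - norm (x - a)) ` ?F)"
      using key[OF _ F0] by (intro bdd_aboveI[of _ "norm (0 + a) - \<psi> 0"]) auto
    have c1: "\<psi> x - norm (x - a) \<le> c" if "x \<in> ?F" for x
      unfolding c_def using bdd that by (rule cSUP_upper2) simp
    have c2: "c \<le> norm (y + a) - \<psi> y" if "y \<in> ?F" for y
      unfolding c_def using F0 key that by (intro cSUP_least) auto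
    have ext: "\<psi> x + t * c \<le> norm (x + t *\<^sub>R a)" if x: "x \<in> ?F" for x t
    proof (cases t "0::real" rule: linorder_cases)
      case equal
      then show ?thesis using \<psi> x by simp
    next
      case greater
      have "\<psi> x + t * c = t * (\<psi> ((1 / t) *\<^sub>R x) + c)"
        using greater \<psi>(1) by (simp add: linear_scale field_simps)
      also have "\<dots> \<le> t * norm ((1 / t) *\<^sub>R x + a)"
        using c2[OF span_scale[OF x], of "1 / t"] greater by (intro mult_left_mono) auto
      also have "\<dots> = norm (t *\<^sub>R ((1 / t) *\<^sub>R x + a))" using greater by simp
      also have "\<dots> = norm (x + t *\<^sub>R a)" using greater by (simp add: algebra_simps)
      finally show ?thesis .
    next
      case less
      have "\<psi> x + t * c = - t * (\<psi> ((- 1 / t) *\<^sub>R x) - c)"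
        using less \<psi>(1) by (simp add: linear_scale linear_neg field_simps)
      also have "\<dots> \<le> - t * norm ((- 1 / t) *\<^sub>R x - a)"
        using c1[OF span_scale[OF x], of "- 1 / t"] less by (intro mult_left_mono) auto
      also have "\<dots> = norm ((- t) *\<^sub>R ((- 1 / t) *\<^sub>R x - a))" using less by simp
      also have "\<dots> = norm (x + t *\<^sub>R a)" using less by (simp add: algebra_simps)
      finally show ?thesis .
    qed
    \<comment> \<open>The correction by \<open>\<pi>\<close> leaves \<open>\<psi>\<close> unchanged
      on the old span and gives \<open>a\<close> the value \<open>c\<close>.\<close>
    define \<psi>' where "\<psi>' y = \<psi> y + (c - \<psi> a) * \<pi> y" for y
    have "linear \<psi>'"
      using \<psi>(1) \<pi>(1) unfolding \<psi>'_def
      by (intro linearI) (auto simp: linear_add linear_scale algebra_simps)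
    moreover have "\<psi>' u = norm u" using \<psi> \<pi>F by (simp add: \<psi>'_def span_base)
    moreover have "\<psi>' y \<le> norm y" if "y \<in> span (insert u (insert a B))" for y
    proof -
      from that obtain t where t: "y - t *\<^sub>R a \<in> ?F"
        by (auto simp: insert_commute[of u a] span_insert[of a])
      define x where "x = y - t *\<^sub>R a"
      have y: "y = x + t *\<^sub>R a" "x \<in> ?F" using t by (auto simp: x_def)
      have "\<psi>' y = \<psi> x + t * c"
        using \<psi>(1) \<pi> \<pi>F[OF y(2)] unfolding y(1) \<psi>'_def
        by (simp add: linear_add linear_scale algebra_simps)
      then show ?thesis using ext[OF y(2), of t] y(1) by simp
    qed
    ultimately show ?thesis by blast
  qed
qed

subsection \<open>Copies of finite-dimensional lp spaces\<close>

text \<open>The vectors \<open>e i\<close> span a copy of \<open>l_p^n\<close>; the lower constant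
  is normalised to one, so \<open>C\<close> alone measures the distortion.\<close>

definition lp_system :: "ennreal \<Rightarrow> real \<Rightarrow> nat \<Rightarrow> (nat \<Rightarrow> 'b::real_normed_vector) \<Rightarrow> bool" where
  "lp_system p C n e \<longleftrightarrow> (\<forall>v. ell_norm p n v \<le> norm (\<Sum>i<n. v i *\<^sub>R e i) \<and>
     norm (\<Sum>i<n. v i *\<^sub>R e i) \<le> C * ell_norm p n v)"

text \<open>For each consecutive pair \<open>e (2 * i)\<close>, \<open>e (Suc (2 * i))\<close> some
  nonzero coefficient pair yields a vector killed by the functional; normalised in the
  two-dimensional \<open>p\<close>-norm, these vectors form a system with the same constant by
  \<open>ell_norm_double\<close>.\<close>

lemma lp_system_in_kernel:
  fixes e :: "nat \<Rightarrow> 'b::real_normed_vector" and \<psi> :: "'b \<Rightarrow> real"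
  assumes p: "1 \<le> p" and n: "1 \<le> n" and e: "lp_system p C (2 * n) e" and \<psi>: "linear \<psi>"
  shows "\<exists>e'. lp_system p C n e' \<and> (\<forall>i<n. e' i \<in> span (e ` {..<2 * n}) \<and> \<psi> (e' i) = 0)"
proof -
  \<comment> \<open>If \<open>\<psi>\<close> takes the values \<open>a\<close>, \<open>b\<close> on
    the pair, the coefficients \<open>(b, - a)\<close> annihilate it; when \<open>a = 0\<close> the
    coefficients \<open>(1, 0)\<close> do, so they never vanish together.\<close>
  define w0 :: "nat \<Rightarrow> nat \<Rightarrow> real" where "w0 i b =
    (if \<psi> (e (2 * i)) = 0 then (if b = 0 then 1 else 0)
     else (if b = 0 then \<psi> (e (Suc (2 * i))) else - \<psi> (e (2 * i))))" for i b
  define s where "s i = ell_norm p 2 (w0 i)" for i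
  have s: "0 < s i" for i
  proof -
    have "0 < \<bar>w0 i 0\<bar> \<or> 0 < \<bar>w0 i 1\<bar>" by (auto simp: w0_def)
    then show ?thesis
      using coord_le_ell_norm[OF p, of 0 2 "w0 i"] coord_le_ell_norm[OF p, of 1 2 "w0 i"]
      by (auto simp: s_def)
  qed
  define w where "w i b = (1 / s i) * w0 i b" for i b
  have w1: "ell_norm p 2 (w i) = 1" for i
    using s[of i] ell_norm_scale[OF p, of 2 "1 / s i" "w0 i"] by (simp add: w_def[abs_def] s_def)
  define e' where "e' i = w i 0 *\<^sub>R e (2 * i) + w i 1 *\<^sub>R e (Suc (2 * i))" for i
  have "(\<Sum>i<n. v i *\<^sub>R e' i) = (\<Sum>j<2 * n. (v (j div 2) * w (j div 2) (j mod 2)) *\<^sub>R e j)" for v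
    by (simp add: sum_lessThan_double e'_def scaleR_add_right)
  then have "lp_system p C n e'"
    using e ell_norm_double[OF p n, of w] w1 unfolding lp_system_def by metis
  moreover have "e' i \<in> span (e ` {..<2 * n})" if "i < n" for i
    unfolding e'_def using that by (intro span_add span_scale span_base) auto
  moreover have "\<psi> (e' i) = 0" for i
    using \<psi> by (simp add: e'_def linear_add linear_scale w_def w0_def)
  ultimately show ?thesis by blast
qed

text \<open>Each functional costs half of the vectors, whence the factor \<open>2 ^ card K\<close>.
  Functionals already handled stay zero because later vectors are combinations of earlier
  ones.\<close>

lemma lp_system_in_kernels:
  fixes \<psi> :: "'c \<Rightarrow> 'b::real_normed_vector \<Rightarrow> real"
  assumes p: "1 \<le> p" and m: "1 \<le> m" and K: "finite K" and \<psi>: "\<And>x. linear (\<psi> x)"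
    and e: "lp_system p C (2 ^ card K * m) e"
  shows "\<exists>e'. lp_system p C m e' \<and>
    (\<forall>i<m. e' i \<in> span (e ` {..<2 ^ card K * m}) \<and> (\<forall>x\<in>K. \<psi> x (e' i) = 0))"
  using K e
proof (induction K arbitrary: e rule: finite_induct)
  case empty
  then show ?case by (auto intro!: exI[of _ e] span_base)
next
  case (insert x K)
  let ?n = "2 ^ card K * m"
  have n: "1 \<le> ?n" using m by simp
  have n2: "2 ^ card (insert x K) * m = 2 * ?n" using insert.hyps by simp
  with insert.prems lp_system_in_kernel[OF p n _ \<psi>, of C e x] obtain e1 where
    e1: "lp_system p C ?n e1" "\<And>i. i < ?n \<Longrightarrow> e1 i \<in> span (e ` {..<2 * ?n}) \<and> \<psi> x (e1 i) = 0"
    by auto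
  from insert.IH[OF e1(1)] obtain e' where
    e': "lp_system p C m e'" "\<And>i. i < m \<Longrightarrow> e' i \<in> span (e1 ` {..<?n}) \<and> (\<forall>x\<in>K. \<psi> x (e' i) = 0)"
    by auto
  have "span (e1 ` {..<?n}) \<subseteq> span (e ` {..<2 * ?n})"
    using e1(2) by (intro span_minimal) auto
  moreover have "\<psi> x y = 0" if "y \<in> span (e1 ` {..<?n})" for y
    using linear_eq_0_on_span[OF \<psi>, of "e1 ` {..<?n}" x y] e1(2) that by auto
  ultimately have "e' i \<in> span (e ` {..<2 ^ card (insert x K) * m}) \<and> (\<forall>x\<in>insert x K. \<psi> x (e' i) = 0)" if "i < m" for i
    using e'(2)[OF that] unfolding n2 by auto
  with e'(1) show ?case by blast
qed

section \<open>Almost orthogonal sequences of copies\<close>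

lemma compact_finite_net:
  fixes S :: "'b::real_normed_vector set"
  assumes "compact S" "0 < \<eta>"
  shows "\<exists>K. finite K \<and> S \<subseteq> (\<Union>x\<in>K. ball x \<eta>)"
proof -
  have "complete S \<and> (\<forall>e>0. \<exists>k. finite k \<and> S \<subseteq> (\<Union>x\<in>k. ball x e))"
    using assms(1) compact_eq_totally_bounded by (rule rev_iffD1)
  then show ?thesis using assms(2) by (elim conjE allE impE)
qed

text \<open>Mazur's technique: the new system is chosen in the kernel of finitely many functionals
  that almost norm the given finite-dimensional subspace.\<close>

lemma lp_system_almost_orthogonal:
  fixes B :: "'b::real_normed_vector set"
  assumes p: "1 \<le> p" and m: "1 \<le> m" and B: "finite B" and \<delta>: "0 < \<delta>"
    and sys: "\<And>n. 1 \<le> n \<Longrightarrow> \<exists>e::nat \<Rightarrow> 'b. lp_system p C n e"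
  shows "\<exists>e. lp_system p C m e \<and>
    (\<forall>u \<in> span B. \<forall>v. norm u \<le> (1 + \<delta>) * norm (u + (\<Sum>i<m. v i *\<^sub>R e i)))"
proof -
  \<comment> \<open>Chosen so that \<open>1 - 2 * \<eta>\<close> is the reciprocal of
    \<open>1 + \<delta>\<close>; one \<open>\<eta>\<close> is lost in the norm of the net point and
    one in evaluating its functional at \<open>u\<close>.\<close>
  define \<eta> where "\<eta> = \<delta> / (2 * (1 + \<delta>))"
  have \<eta>: "0 < \<eta>" "(1 + \<delta>) * (1 - 2 * \<eta>) = 1" using \<delta> by (auto simp: \<eta>_def field_simps)
  obtain K where K: "finite K" "span B \<inter> cball 0 1 \<subseteq> (\<Union>x\<in>K. ball x \<eta>)"
    using compact_finite_net[OF compact_span_Int_cball[OF B, of 1] \<eta>(1)] by (elim exE conjE)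
  have "1 \<le> 2 ^ card K * m" using m by simp
  from sys[OF this] obtain e :: "nat \<Rightarrow> 'b" where e: "lp_system p C (2 ^ card K * m) e" by blast
  let ?E = "e ` {..<2 ^ card K * m}"
  \<comment> \<open>The net points are not known to lie in \<open>span B\<close>, so
    \<open>x\<close> itself is put into the span on which its functional is bounded.\<close>
  have "\<exists>\<psi>::'b \<Rightarrow> real. linear \<psi> \<and> (\<forall>y \<in> span (insert x (B \<union> ?E)). \<psi> y \<le> norm y) \<and> \<psi> x = norm x" for x
    using B by (intro norming_functional_on_span) auto
  then obtain \<psi> :: "'b \<Rightarrow> 'b \<Rightarrow> real" where \<psi>: "\<And>x. linear (\<psi> x)"
    "\<And>x y. y \<in> span (insert x (B \<union> ?E)) \<Longrightarrow> \<psi> x y \<le> norm y" "\<And>x. \<psi> x x = norm x" by metis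
  from lp_system_in_kernels[where \<psi> = \<psi>, OF p m K(1) \<psi>(1) e]
  obtain e' where e': "lp_system p C m e'"
    "\<And>i. i < m \<Longrightarrow> e' i \<in> span ?E" "\<And>i x. i < m \<Longrightarrow> x \<in> K \<Longrightarrow> \<psi> x (e' i) = 0" by auto
  \<comment> \<open>\<open>\<psi> x\<close> vanishes on the new vectors and nearly norms
    \<open>u\<close>, so adding them cannot shrink \<open>u\<close> by much.\<close>
  have unit: "1 \<le> (1 + \<delta>) * norm (u + (\<Sum>i<m. v i *\<^sub>R e' i))" if u: "u \<in> span B" "norm u = 1" for u v
  proof -
    have "u \<in> span B \<inter> cball 0 1" using u by simp
    then have "u \<in> (\<Union>x\<in>K. ball x \<eta>)" by (rule subsetD[OF K(2)])
    then obtain x where x: "x \<in> K" "norm (x - u) < \<eta>" unfolding UN_iff mem_ball dist_norm by (elim bexE)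
    let ?S = "span (insert x (B \<union> ?E))" and ?w = "\<Sum>i<m. v i *\<^sub>R e' i"
    have sub: "span B \<subseteq> ?S" "span ?E \<subseteq> ?S" by (auto intro!: span_mono)
    have xS: "x \<in> ?S" by (simp add: span_base)
    have w: "?w \<in> ?S" using e'(2) sub by (intro span_sum span_scale) auto
    have "\<psi> x ?w = 0" using e'(3) x(1) \<psi>(1) by (simp add: linear_sum linear_scale)
    then have "\<psi> x (u + ?w) = \<psi> x x - \<psi> x (x - u)" using \<psi>(1) by (simp add: linear_add linear_diff)
    moreover have "\<psi> x (x - u) \<le> norm (x - u)" using u sub xS by (intro \<psi>(2) span_diff) auto
    moreover have "1 \<le> norm x + norm (x - u)" using norm_triangle_ineq2[of u x] u by (simp add: norm_minus_commute)
    moreover have "\<psi> x (u + ?w) \<le> norm (u + ?w)" using u w sub by (intro \<psi>(2) span_add) auto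
    ultimately have "1 - 2 * \<eta> \<le> norm (u + ?w)" using x(2) \<psi>(3)[of x] by linarith
    then have "(1 + \<delta>) * (1 - 2 * \<eta>) \<le> (1 + \<delta>) * norm (u + ?w)" using \<delta> by (intro mult_left_mono) auto
    then show ?thesis using \<eta> by simp
  qed
  have "norm u \<le> (1 + \<delta>) * norm (u + (\<Sum>i<m. v i *\<^sub>R e' i))" if u: "u \<in> span B" for u v
  proof (cases "u = 0")
    case True
    then show ?thesis using \<delta> by simp
  next
    case False
    let ?r = "norm u"
    have eq: "u + (\<Sum>i<m. v i *\<^sub>R e' i) = ?r *\<^sub>R ((1 / ?r) *\<^sub>R u + (\<Sum>i<m. (v i / ?r) *\<^sub>R e' i))"
      using False by (simp add: scaleR_add_right scaleR_sum_right)
    have "1 \<le> (1 + \<delta>) * norm ((1 / ?r) *\<^sub>R u + (\<Sum>i<m. (v i / ?r) *\<^sub>R e' i))"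
      using u False by (intro unit span_scale) auto
    then have "?r * 1 \<le> ?r * ((1 + \<delta>) * norm ((1 / ?r) *\<^sub>R u + (\<Sum>i<m. (v i / ?r) *\<^sub>R e' i)))"
      by (intro mult_left_mono) auto
    then show ?thesis unfolding eq by (simp add: mult.left_commute)
  qed
  with e'(1) show ?thesis by blast
qed

text \<open>Blocks are chosen one after another, each almost orthogonal to the span of the previous
  ones, with constants whose product stays below two. A single block is a difference of two partial
  sums, which gives the factor four.\<close>

lemma lp_system_sequence:
  assumes p: "1 \<le> p" and m: "\<And>k. 1 \<le> m k"
    and sys: "\<And>n. 1 \<le> n \<Longrightarrow> \<exists>e::nat \<Rightarrow> 'b::real_normed_vector. lp_system p C n e"
  shows "\<exists>e::nat \<Rightarrow> nat \<Rightarrow> 'b. (\<forall>k. lp_system p C (m k) (e k)) \<and>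
    (\<forall>v N i. i < N \<longrightarrow> norm (\<Sum>j<m i. v i j *\<^sub>R e i j) \<le> 4 * norm (\<Sum>k<N. \<Sum>j<m k. v k j *\<^sub>R e k j))"
proof -
  \<comment> \<open>Increasing from one towards two, so the ratios \<open>g (Suc k) / g k\<close>
    serve as the successive constants and their product telescopes.\<close>
  define g :: "nat \<Rightarrow> real" where "g k = 2 - (1 / 2) ^ k" for k
  have gpos: "1 \<le> g k" "g k \<le> 2" for k by (auto simp: g_def power_le_one)
  have gS: "g k < g (Suc k)" for k by (simp add: g_def)
  define P where "P e x r \<longleftrightarrow> lp_system p C (m x) r \<and>
      (\<forall>u \<in> span (\<Union>k<x. e k ` {..<m k}). \<forall>v. norm u \<le> (1 + (g (Suc x) / g x - 1)) * norm (u + (\<Sum>i<m x. v i *\<^sub>R r i)))"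
    for e :: "nat \<Rightarrow> nat \<Rightarrow> 'b" and x r
  \<comment> \<open>The condition on block \<open>x\<close> involves only the earlier blocks, so the
    choice is a well-founded recursion.\<close>
  have "\<exists>e. \<forall>x. P e x (e x)"
  proof (rule dependent_wellorder_choice)
    show "P e x r = P e' x r" if "\<And>y. y < x \<Longrightarrow> e y = e' y" for r e e' x
    proof -
      have "(\<Union>k<x. e k ` {..<m k}) = (\<Union>k<x. e' k ` {..<m k})" using that by auto
      then show ?thesis unfolding P_def by simp
    qed
    show "\<exists>r. P e x r" for e x
      unfolding P_def using gS[of x] gpos(1)[of x]
      by (intro lp_system_almost_orthogonal p m sys) auto
  qed
  then obtain e where e: "\<And>x. P e x (e x)" by blast
  have "norm (\<Sum>j<m i. v i j *\<^sub>R e i j) \<le> 4 * norm (\<Sum>k<N. \<Sum>j<m k. v k j *\<^sub>R e k j)"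
    if "i < N" for v N i
  proof -
    define S where "S K = (\<Sum>k<K. \<Sum>j<m k. v k j *\<^sub>R e k j)" for K
    have mem: "S K \<in> span (\<Union>k<K. e k ` {..<m k})" for K
      unfolding S_def by (intro span_sum span_scale span_base) auto
    have step: "norm (S K) \<le> g (Suc K) / g K * norm (S (Suc K))" for K
      using e[of K] mem[of K] by (auto simp: P_def S_def)
    have "g K * norm (S K) \<le> g (Suc K) * norm (S (Suc K))" for K
    proof -
      have "g K * norm (S K) \<le> g K * (g (Suc K) / g K * norm (S (Suc K)))"
        using gpos(1)[of K] step[of K] by (intro mult_left_mono) auto
      then show ?thesis using gpos(1)[of K] by simp
    qed
    then have mono: "g K * norm (S K) \<le> g N * norm (S N)" if "K \<le> N" for K
      using lift_Suc_mono_le[of "\<lambda>K. g K * norm (S K)" K N] that by blast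
    have le2: "norm (S K) \<le> 2 * norm (S N)" if "K \<le> N" for K
    proof -
      have "1 * norm (S K) \<le> g K * norm (S K)" using gpos by (intro mult_right_mono) auto
      also note mono[OF that]
      also have "g N * norm (S N) \<le> 2 * norm (S N)" using gpos by (intro mult_right_mono) auto
      finally show ?thesis by simp
    qed
    have "(\<Sum>j<m i. v i j *\<^sub>R e i j) = S (Suc i) - S i" by (simp add: S_def)
    then have "norm (\<Sum>j<m i. v i j *\<^sub>R e i j) \<le> norm (S (Suc i)) + norm (S i)"
      by (simp only: norm_triangle_ineq4)
    then show ?thesis using le2[of i] le2[of "Suc i"] that by (simp add: S_def)
  qed
  moreover have "lp_system p C (m k) (e k)" for k using e[of k] by (simp add: P_def)
  ultimately show ?thesis by blast
qed

section \<open>From the Banach-Mazur distance to systems of vectors\<close>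

lemma lookup_scaleR: "Poly_Mapping.lookup (c *\<^sub>R x) i = c * Poly_Mapping.lookup x i"
  for x :: "'a \<Rightarrow>\<^sub>0 real"
proof -
  have "finite {i. c *\<^sub>R Poly_Mapping.lookup x i \<noteq> 0}"
    by (rule finite_subset[OF _ finite_lookup[of x]]) auto
  then show ?thesis by (simp add: scaleR_poly_mapping_def lookup_Abs_poly_mapping)
qed

lemma lp_norm_eq_ell_norm: "lp_norm p n x = ell_norm p n (Poly_Mapping.lookup x)"
  by (simp add: lp_norm_def ell_norm_def)

lemma linear_iso_on_sum:
  fixes n :: nat
  assumes T: "linear_iso_on E F T" and E: "subspace E" "\<And>i. i < n \<Longrightarrow> x i \<in> E"
  shows "T (\<Sum>i<n. c i *\<^sub>R x i) = (\<Sum>i<n. c i *\<^sub>R T (x i))"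
  using E(2)
proof (induct n)
  case 0
  have "T (0 *\<^sub>R 0) = 0 *\<^sub>R T 0"
    using T subspace_0[OF E(1)] unfolding linear_iso_on_def by blast
  then show ?case by simp
next
  case (Suc n)
  have "T ((\<Sum>i<n. c i *\<^sub>R x i) + c n *\<^sub>R x n) = T (\<Sum>i<n. c i *\<^sub>R x i) + T (c n *\<^sub>R x n)"
  proof -
    have "(\<Sum>i<n. c i *\<^sub>R x i) \<in> E" "c n *\<^sub>R x n \<in> E"
      using Suc(2) by (auto intro!: subspace_sum[OF E(1)] subspace_scale[OF E(1)])
    then show ?thesis using T by (auto simp: linear_iso_on_def)
  qed
  moreover have "T (c n *\<^sub>R x n) = c n *\<^sub>R T (x n)"
    using T Suc(2) unfolding linear_iso_on_def by auto
  ultimately show ?case using Suc by simp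
qed

lemma linear_iso_on_inv_into:
  assumes T: "linear_iso_on E F T" and E: "subspace E"
  shows "linear_iso_on F E (inv_into E T)"
  unfolding linear_iso_on_def
proof (intro conjI ballI allI)
  have bij: "bij_betw T E F" and add: "\<And>x y. x \<in> E \<Longrightarrow> y \<in> E \<Longrightarrow> T (x + y) = T x + T y"
    and scale: "\<And>c x. x \<in> E \<Longrightarrow> T (c *\<^sub>R x) = c *\<^sub>R T x"
    using T by (auto simp: linear_iso_on_def)
  have inj: "inj_on T E" and F: "F = T ` E" using bij by (auto simp: bij_betw_def)
  show "bij_betw (inv_into E T) F E" by (rule bij_betw_inv_into[OF bij])
  fix y assume "y \<in> F"
  then obtain x where x: "x \<in> E" "y = T x" using F by blast
  show "inv_into E T (c *\<^sub>R y) = c *\<^sub>R inv_into E T y" for c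
    using x inj E by (simp flip: scale add: inv_into_f_f subspace_scale)
  fix y' assume "y' \<in> F"
  then obtain x' where x': "x' \<in> E" "y' = T x'" using F by blast
  show "inv_into E T (y + y') = inv_into E T y + inv_into E T y'"
    using x x' inj E by (simp flip: add add: inv_into_f_f subspace_add)
qed

lemma op_norm_on_finite:
  assumes T: "linear_iso_on E F T" and E: "subspace E"
    and N: "\<And>c x. x \<in> E \<Longrightarrow> N (c *\<^sub>R x) = \<bar>c\<bar> * N x" "\<And>x. x \<in> E \<Longrightarrow> x \<noteq> 0 \<Longrightarrow> 0 < N x"
    and N': "\<And>c x. x \<in> F \<Longrightarrow> N' (c *\<^sub>R x) = \<bar>c\<bar> * N' x" "\<And>x. x \<in> F \<Longrightarrow> 0 \<le> N' x"
    and fin: "op_norm_on E N N' T = ennreal A" "0 \<le> A" and x: "x \<in> E"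
  shows "N' (T x) \<le> A * N x"
proof -
  have T0: "T 0 = 0" using linear_iso_on_sum[OF T E, of 0 "\<lambda>_. 0"] by simp
  have F0: "0 \<in> F" using T subspace_0[OF E] T0 unfolding linear_iso_on_def bij_betw_def by force
  have Nz: "N 0 = 0" "N' 0 = 0" using N(1)[of 0 0] N'(1)[of 0 0] F0 subspace_0[OF E] by auto
  have TF: "T z \<in> F" if "z \<in> E" for z using T that by (auto simp: linear_iso_on_def bij_betw_def)
  show ?thesis
  proof (cases "x = 0")
    case True
    then show ?thesis using T0 Nz by simp
  next
    case False
    have pos: "0 < N x" using N(2) x False by blast
    have "(1 / N x) *\<^sub>R x \<in> {x \<in> E. N x \<le> 1}" using x N(1)[OF x] pos E by (simp add: subspace_scale)
    then have "ennreal (N' (T ((1 / N x) *\<^sub>R x))) \<le> ennreal A"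
      unfolding fin(1)[symmetric] op_norm_on_def by (rule SUP_upper)
    moreover have "T ((1 / N x) *\<^sub>R x) = (1 / N x) *\<^sub>R T x"
      using T x by (auto simp: linear_iso_on_def)
    ultimately have "N' (T x) / N x \<le> A" using fin(2) N'(1)[OF TF[OF x], of "1 / N x"] pos by simp
    then show ?thesis using pos by (simp add: field_simps)
  qed
qed

text \<open>Since \<open>0 * top = 0\<close> in \<open>ennreal\<close>, a finite product of operator
  norms alone does not make both factors finite; it does once both are known to be nonzero.\<close>

lemma op_norm_on_pos:
  assumes T: "linear_iso_on E F T" and E: "subspace E"
    and N: "\<And>c x. x \<in> E \<Longrightarrow> N (c *\<^sub>R x) = \<bar>c\<bar> * N x" "\<And>x. x \<in> E \<Longrightarrow> x \<noteq> 0 \<Longrightarrow> 0 < N x"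
    and N': "\<And>x. x \<in> F \<Longrightarrow> x \<noteq> 0 \<Longrightarrow> 0 < N' x"
    and x: "x \<in> E" "x \<noteq> 0"
  shows "op_norm_on E N N' T \<noteq> 0"
proof
  assume z: "op_norm_on E N N' T = 0"
  have pos: "0 < N x" using N(2) x by blast
  have mem: "(1 / N x) *\<^sub>R x \<in> {x \<in> E. N x \<le> 1}" using x N(1)[OF x(1)] pos E by (simp add: subspace_scale)
  then have "ennreal (N' (T ((1 / N x) *\<^sub>R x))) \<le> 0"
    unfolding z[symmetric] op_norm_on_def by (rule SUP_upper)
  moreover have "T ((1 / N x) *\<^sub>R x) \<in> F" using T mem by (auto simp: linear_iso_on_def bij_betw_def)
  ultimately have "T ((1 / N x) *\<^sub>R x) = 0" using N' by (metis ennreal_eq_0_iff le_zero_eq not_less)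
  moreover have "T 0 = 0" using linear_iso_on_sum[OF T E, of 0 "\<lambda>_. 0"] by simp
  moreover have "inj_on T E" using T by (auto simp: linear_iso_on_def bij_betw_def)
  ultimately have "(1 / N x) *\<^sub>R x = 0" using mem subspace_0[OF E] by (metis (mono_tags, lifting) inj_onD mem_Collect_eq)
  then show False using x pos by simp
qed

text \<open>The unit vectors are pulled back through an almost optimal isomorphism and rescaled,
  which moves the whole distortion into the upper estimate.\<close>

lemma contains_lp_uniformly_imp_lp_system:
  assumes p: "1 \<le> p" and Y: "contains_lp_uniformly p (UNIV :: 'b::real_normed_vector set)"
  shows "\<exists>C\<ge>1. \<forall>n\<ge>1. \<exists>e::nat \<Rightarrow> 'b. lp_system p C n e"
proof -
  obtain C E where C: "1 \<le> C" and E: "\<And>n. 1 \<le> n \<Longrightarrow> subspace (E n :: 'b set)"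
    and BM: "\<And>n. 1 \<le> n \<Longrightarrow> Banach_Mazur_dist (E n) norm (lp_space n) (lp_norm p n) \<le> ennreal C"
    using Y unfolding contains_lp_uniformly_def by blast
  have "\<exists>e::nat \<Rightarrow> 'b. lp_system p (C + 1) n e" if n: "1 \<le> n" for n
  proof -
    let ?L = "lp_space n" and ?N = "lp_norm p n"
    \<comment> \<open>The infimum need not be attained, so the larger constant \<open>C + 1\<close>
      is used to pick an actual isomorphism.\<close>
    have "Banach_Mazur_dist (E n) norm ?L ?N < ennreal (C + 1)"
      using BM[OF n] by (rule order_le_less_trans) (use C in \<open>simp add: ennreal_less_iff\<close>)
    then obtain T where T: "linear_iso_on (E n) ?L T"
      and op: "op_norm_on (E n) norm ?N T * op_norm_on ?L ?N norm (inv_into (E n) T) < ennreal (C + 1)"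
      unfolding Banach_Mazur_dist_def INF_less_iff by blast
    define U where "U = inv_into (E n) T"
    have U: "linear_iso_on ?L (E n) U" unfolding U_def by (rule linear_iso_on_inv_into[OF T E[OF n]])
    have L: "subspace ?L"
      unfolding subspace_def lp_space_def by (auto simp: in_keys_iff lookup_add lookup_scaleR subset_iff) (metis add_0)
    have Nscale: "?N (c *\<^sub>R x) = \<bar>c\<bar> * ?N x" for c x
    proof -
      have "Poly_Mapping.lookup (c *\<^sub>R x) = (\<lambda>i. c * Poly_Mapping.lookup x i)" by (rule ext) (rule lookup_scaleR)
      then show ?thesis unfolding lp_norm_eq_ell_norm by (simp only: ell_norm_scale[OF p n])
    qed
    have Npos: "0 < ?N x" if "x \<in> ?L" "x \<noteq> 0" for x
    proof -
      from \<open>x \<noteq> 0\<close> obtain i where i: "i \<in> Poly_Mapping.keys x" using keys_eq_empty by blast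
      then have "0 < \<bar>Poly_Mapping.lookup x i\<bar>" by (simp add: in_keys_iff)
      also have "\<dots> \<le> ?N x"
        unfolding lp_norm_eq_ell_norm using i that by (intro coord_le_ell_norm p) (auto simp: lp_space_def)
      finally show ?thesis .
    qed
    have \<delta>: "Poly_Mapping.single i (1::real) \<in> ?L" "Poly_Mapping.single i (1::real) \<noteq> 0" if "i < n" for i
      using that lookup_single_eq[of i "1::real"] by (auto simp: lp_space_def simp del: lookup_single_eq)
    have TU: "T (U y) = y" if "y \<in> ?L" for y
      unfolding U_def using T that by (intro f_inv_into_f) (auto simp: linear_iso_on_def bij_betw_def)
    have UE: "U y \<in> E n" if "y \<in> ?L" for y
      using U that by (auto simp: linear_iso_on_def bij_betw_def)
    have T0: "T 0 = 0" using linear_iso_on_sum[OF T E[OF n], of 0 "\<lambda>_. 0"] by simp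
    have n0: "0 < n" using n by simp
    have opT: "op_norm_on (E n) norm ?N T \<noteq> 0"
      using UE[OF \<delta>(1)[OF n0]] TU[OF \<delta>(1)[OF n0]] T0 \<delta>(2)[OF n0]
      by (intro op_norm_on_pos[OF T E[OF n], of _ _ "U (Poly_Mapping.single 0 1)"] Npos) auto
    have opU: "op_norm_on ?L ?N norm U \<noteq> 0"
      by (rule op_norm_on_pos[OF U L Nscale Npos _ \<delta>[OF n0]]) auto
    have "op_norm_on (E n) norm ?N T \<noteq> top" "op_norm_on ?L ?N norm U \<noteq> top"
      using op opT opU unfolding U_def[symmetric] by (auto simp: ennreal_mult_eq_top_iff)
    then obtain A B where A: "op_norm_on (E n) norm ?N T = ennreal A" "0 \<le> A"
      and B: "op_norm_on ?L ?N norm U = ennreal B" "0 \<le> B"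
      by (metis ennreal_cases)
    have AB: "A * B < C + 1"
    proof -
      have "ennreal (A * B) < ennreal (C + 1)"
        using op unfolding U_def[symmetric] A(1) B(1) ennreal_mult[OF A(2) B(2)] .
      then show ?thesis using A(2) B(2) by (subst (asm) ennreal_less_iff) auto
    qed
    have TA: "?N (T x) \<le> A * norm x" if "x \<in> E n" for x
      by (rule op_norm_on_finite[OF T E[OF n] _ _ Nscale _ A that])
        (auto simp: lp_norm_eq_ell_norm intro: ell_norm_nonneg[OF p n])
    have UB: "norm (U y) \<le> B * ?N y" if "y \<in> ?L" for y
      by (rule op_norm_on_finite[OF U L Nscale Npos _ _ B that]) auto
    \<comment> \<open>The factor \<open>A\<close>, the norm of \<open>T\<close>, makes the lower
      constant one; the upper one becomes \<open>A * B\<close>, which is below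
      \<open>C + 1\<close>.\<close>
    define e where "e i = A *\<^sub>R U (Poly_Mapping.single i 1)" for i
    have "ell_norm p n v \<le> norm (\<Sum>i<n. v i *\<^sub>R e i) \<and> norm (\<Sum>i<n. v i *\<^sub>R e i) \<le> (C + 1) * ell_norm p n v" for v
    proof -
      define y where "y = (\<Sum>i<n. v i *\<^sub>R Poly_Mapping.single i (1::real))"
      have y: "y \<in> ?L" unfolding y_def using \<delta> L by (intro subspace_sum subspace_scale) auto
      have "Poly_Mapping.lookup y i = (if i < n then v i else 0)" for i
        unfolding y_def by (simp add: lookup_sum lookup_scaleR lookup_single when_def if_distrib sum.delta cong: if_cong)
      then have Ny: "?N y = ell_norm p n v" unfolding lp_norm_eq_ell_norm by (intro ell_norm_cong) auto
      have "(\<Sum>i<n. v i *\<^sub>R e i) = A *\<^sub>R U y"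
        unfolding y_def e_def using linear_iso_on_sum[OF U L, of n "\<lambda>i. Poly_Mapping.single i 1" v] \<delta>
        by (simp add: scaleR_sum_right mult.commute)
      then have n: "norm (\<Sum>i<n. v i *\<^sub>R e i) = A * norm (U y)" using A by simp
      have "A * norm (U y) \<le> A * (B * ell_norm p n v)"
        using UB[OF y] A Ny by (intro mult_left_mono) auto
      also have "\<dots> \<le> (C + 1) * ell_norm p n v"
        using AB ell_norm_nonneg[OF p \<open>1 \<le> n\<close>, of v] by (simp flip: mult.assoc add: mult_right_mono)
      finally show ?thesis using TA[OF UE[OF y]] TU[OF y] Ny n by simp
    qed
    then show ?thesis unfolding lp_system_def by blast
  qed
  then show ?thesis using C by (intro exI[of _ "C + 1"]) auto
qed

section \<open>Linear structure, null modifications and integrability in \<open>L_p\<close>\<close>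

interpretation unit_lebesgue: finite_measure unit_lebesgue
  by (rule finite_measureI) (simp add: emeasure_restrict_space)

lemma Lp_norm_leI:
  assumes p: "1 \<le> p" "p \<noteq> top" and c: "0 \<le> c"
    and le: "(\<integral>x. \<bar>f x\<bar> powr enn2real p \<partial>unit_lebesgue) \<le> c powr enn2real p"
  shows "Lp_norm p f \<le> c"
proof (rule ccontr)
  assume "\<not> Lp_norm p f \<le> c"
  then have "c powr enn2real p < Lp_norm p f powr enn2real p"
    using c finite_exponent[OF p] by (intro powr_less_mono2) auto
  then show False using le Lp_norm_powr[OF p, of f] by simp
qed

lemma Lp_scale:
  assumes p: "1 \<le> p" and f: "f \<in> Lp_functions p"
  shows "(\<lambda>x. c * f x) \<in> Lp_functions p" "Lp_norm p (\<lambda>x. c * f x) \<le> \<bar>c\<bar> * Lp_norm p f"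
proof -
  have m: "f \<in> borel_measurable unit_lebesgue" using f by (simp add: Lp_functions_def)
  have "(\<lambda>x. c * f x) \<in> Lp_functions p \<and> Lp_norm p (\<lambda>x. c * f x) \<le> \<bar>c\<bar> * Lp_norm p f"
  proof (cases "p = top")
    case True
    have "AE x in unit_lebesgue. \<bar>c * f x\<bar> \<le> \<bar>c\<bar> * Lp_norm top f"
      using Lp_norm_top_bound[OF f[unfolded True]]
      by eventually_elim (simp add: abs_mult mult_left_mono)
    then show ?thesis using Lp_norm_top_leI[of "\<lambda>x. c * f x"] m True by auto
  next
    case False
    have i: "integrable unit_lebesgue (\<lambda>x. \<bar>f x\<bar> powr enn2real p)"
      using f False by (simp add: Lp_functions_def)
    have "(\<integral>x. \<bar>c * f x\<bar> powr enn2real p \<partial>unit_lebesgue) = (\<bar>c\<bar> * Lp_norm p f) powr enn2real p"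
      using Lp_norm_powr[OF p False, of f] Lp_norm_nonneg[of p f] by (simp add: abs_mult powr_mult)
    then have "Lp_norm p (\<lambda>x. c * f x) \<le> \<bar>c\<bar> * Lp_norm p f"
      using Lp_norm_nonneg[of p f] by (intro Lp_norm_leI p False) auto
    then show ?thesis using i m False by (auto simp: Lp_functions_def abs_mult powr_mult)
  qed
  then show "(\<lambda>x. c * f x) \<in> Lp_functions p" "Lp_norm p (\<lambda>x. c * f x) \<le> \<bar>c\<bar> * Lp_norm p f" by auto
qed

lemma Lp_lincomb:
  assumes p: "1 \<le> p" and f: "f \<in> Lp_functions p" "g \<in> Lp_functions p"
  shows "(\<lambda>x. a * f x + b * g x) \<in> Lp_functions p"
    and "Lp_norm p (\<lambda>x. a * f x + b * g x) \<le> \<bar>a\<bar> * Lp_norm p f + \<bar>b\<bar> * Lp_norm p g"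
proof -
  show "(\<lambda>x. a * f x + b * g x) \<in> Lp_functions p"
    by (intro Lp_add Lp_scale p f)
  have "Lp_norm p (\<lambda>x. a * f x + b * g x) \<le> Lp_norm p (\<lambda>x. a * f x) + Lp_norm p (\<lambda>x. b * g x)"
    by (intro Lp_add Lp_scale p f)
  then show "Lp_norm p (\<lambda>x. a * f x + b * g x) \<le> \<bar>a\<bar> * Lp_norm p f + \<bar>b\<bar> * Lp_norm p g"
    using Lp_scale(2)[OF p f(1), of a] Lp_scale(2)[OF p f(2), of b] by linarith
qed

text \<open>Functions that agree almost everywhere differ by a function of norm zero, so the
  triangle inequality in both orders gives equality.\<close>

lemma Lp_norm_cong_AE:
  assumes p: "1 \<le> p" and f: "f \<in> Lp_functions p" "g \<in> Lp_functions p"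
    and ae: "AE x in unit_lebesgue. f x = g x"
  shows "Lp_norm p f = Lp_norm p g"
proof -
  have le: "Lp_norm p f \<le> Lp_norm p g" if f: "f \<in> Lp_functions p" "g \<in> Lp_functions p"
    and ae: "AE x in unit_lebesgue. f x = g x" for f g
  proof -
    have d: "(\<lambda>x. f x - g x) \<in> Lp_functions p" by (rule Lp_diff[OF p f])
    have "Lp_norm p (\<lambda>x. f x - g x) = 0"
      using ae by (subst Lp_norm_eq_0_iff[OF p d]) auto
    then show ?thesis using Lp_add(2)[OF p d f(2)] by simp
  qed
  show ?thesis
    using le[OF f ae] le[OF f(2,1)] ae by (simp add: eq_commute[of "f _"])
qed

lemma Lp_functions_cong_AE:
  assumes p: "1 \<le> p" and f: "f \<in> Lp_functions p" and g: "g \<in> borel_measurable unit_lebesgue"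
    and ae: "AE x in unit_lebesgue. f x = g x"
  shows "g \<in> Lp_functions p"
proof (cases "p = top")
  case True
  have "AE x in unit_lebesgue. \<bar>g x\<bar> \<le> Lp_norm top f"
    using ae Lp_norm_top_bound[OF f[unfolded True]] by eventually_elim simp
  then show ?thesis using Lp_norm_top_leI(1)[OF g] True by simp
next
  case False
  have "integrable unit_lebesgue (\<lambda>x. \<bar>g x\<bar> powr enn2real p)"
  proof (rule integrable_cong_AE_imp)
    show "integrable unit_lebesgue (\<lambda>x. \<bar>f x\<bar> powr enn2real p)"
      using f False by (simp add: Lp_functions_def)
    show "AE x in unit_lebesgue. \<bar>f x\<bar> powr enn2real p = \<bar>g x\<bar> powr enn2real p"
      using ae by eventually_elim simp
  qed (use g in measurable)
  then show ?thesis using g False by (simp add: Lp_functions_def)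
qed

text \<open>The interval has finite measure, so essentially bounded functions are integrable, and
  for finite exponents \<open>1 + \<bar>f x\<bar> powr ?q\<close> dominates. This makes averages
  over fibres meaningful.\<close>

lemma Lp_integrable:
  assumes p: "1 \<le> p" and f: "f \<in> Lp_functions p"
  shows "integrable unit_lebesgue f"
proof -
  have m: "f \<in> borel_measurable unit_lebesgue" using f by (simp add: Lp_functions_def)
  show ?thesis
  proof (cases "p = top")
    case True
    have "AE x in unit_lebesgue. norm (f x) \<le> norm (Lp_norm top f)"
      using Lp_norm_top_bound[OF f[unfolded True]] by eventually_elim simp
    then show ?thesis by (intro Bochner_Integration.integrable_bound[OF unit_lebesgue.integrable_const m])
  next
    case False
    let ?q = "enn2real p"
    have q: "1 \<le> ?q" using finite_exponent p False by blast
    have i: "integrable unit_lebesgue (\<lambda>x. 1 + \<bar>f x\<bar> powr ?q)"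
      using f False by (simp add: Lp_functions_def)
    have "\<bar>t\<bar> \<le> 1 + \<bar>t\<bar> powr ?q" for t
    proof (cases "1 \<le> \<bar>t\<bar>")
      case True
      then have "\<bar>t\<bar> powr 1 \<le> \<bar>t\<bar> powr ?q" using q by (intro powr_mono) auto
      then show ?thesis by simp
    next
      case False
      moreover have "0 \<le> \<bar>t\<bar> powr ?q" by simp
      ultimately show ?thesis by linarith
    qed
    then show ?thesis
      by (intro Bochner_Integration.integrable_bound[OF i m] AE_I2) simp
  qed
qed

subsection \<open>Averaging over the fibres of a simple function\<close>

text \<open>A simple function with natural values encodes a finite measurable partition of the unit
  interval; common refinements then amount to pairing labels.\<close>

definition fibre :: "(real \<Rightarrow> nat) \<Rightarrow> nat \<Rightarrow> real set" where
  "fibre \<sigma> i = {x \<in> {0..1}. \<sigma> x = i}"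

text \<open>The conditional expectation of \<open>v\<close> given the partition, as a function of
  the label. Division by zero makes it vanish on null fibres.\<close>

definition fibre_avg :: "(real \<Rightarrow> nat) \<Rightarrow> (real \<Rightarrow> real) \<Rightarrow> nat \<Rightarrow> real" where
  "fibre_avg \<sigma> v i =
     (\<integral>x. indicator (fibre \<sigma> i) x * v x \<partial>unit_lebesgue) / measure unit_lebesgue (fibre \<sigma> i)"

lemma sets_fibre: "simple_function unit_lebesgue \<sigma> \<Longrightarrow> fibre \<sigma> i \<in> sets unit_lebesgue"
proof -
  assume "simple_function unit_lebesgue \<sigma>"
  then have "\<sigma> -` {i} \<inter> space unit_lebesgue \<in> sets unit_lebesgue" by (rule simple_functionD)
  moreover have "\<sigma> -` {i} \<inter> space unit_lebesgue = fibre \<sigma> i" by (auto simp: fibre_def)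
  ultimately show ?thesis by simp
qed

lemma integrable_indicator_mult:
  assumes "A \<in> sets unit_lebesgue" "integrable unit_lebesgue v"
  shows "integrable unit_lebesgue (\<lambda>x. indicator A x * v x :: real)"
  using integrable_mult_indicator[OF assms] by simp

lemma fibre_avg_lincomb:
  assumes \<sigma>: "simple_function unit_lebesgue \<sigma>"
    and v: "integrable unit_lebesgue v" "integrable unit_lebesgue w"
  shows "fibre_avg \<sigma> (\<lambda>x. a * v x + b * w x) i = a * fibre_avg \<sigma> v i + b * fibre_avg \<sigma> w i"
proof -
  note i = integrable_indicator_mult[OF sets_fibre[OF \<sigma>, of i]]
  have "(\<integral>x. indicator (fibre \<sigma> i) x * (a * v x + b * w x) \<partial>unit_lebesgue)
    = (\<integral>x. a * (indicator (fibre \<sigma> i) x * v x) + b * (indicator (fibre \<sigma> i) x * w x) \<partial>unit_lebesgue)"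
    by (intro Bochner_Integration.integral_cong) (auto simp: algebra_simps)
  also have "\<dots> = a * (\<integral>x. indicator (fibre \<sigma> i) x * v x \<partial>unit_lebesgue)
      + b * (\<integral>x. indicator (fibre \<sigma> i) x * w x \<partial>unit_lebesgue)"
    using i[OF v(1)] i[OF v(2)] by simp
  finally show ?thesis by (simp add: fibre_avg_def add_divide_distrib)
qed

lemma fibre_avg_step:
  assumes "measure unit_lebesgue (fibre \<sigma> i) \<noteq> 0" "fibre \<sigma> i \<in> sets unit_lebesgue"
  shows "fibre_avg \<sigma> (\<lambda>x. c (\<sigma> x)) i = c i"
proof -
  have "(\<integral>x. indicator (fibre \<sigma> i) x * c (\<sigma> x) \<partial>unit_lebesgue)
    = (\<integral>x. indicator (fibre \<sigma> i) x * c i \<partial>unit_lebesgue)"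
    by (intro Bochner_Integration.integral_cong) (auto simp: fibre_def indicator_def)
  also have "\<dots> = measure unit_lebesgue (fibre \<sigma> i) * c i"
    using assms(2) sets.sets_into_space[OF assms(2)] by (simp add: Int_absorb2)
  finally show ?thesis using assms by (simp add: fibre_avg_def)
qed

text \<open>Only finitely many labels occur, so the null fibres together form a null set. At all
  other points averaging reproduces step functions.\<close>

lemma AE_fibre_nonnull:
  assumes \<sigma>: "simple_function unit_lebesgue \<sigma>"
  shows "AE x in unit_lebesgue. measure unit_lebesgue (fibre \<sigma> (\<sigma> x)) \<noteq> 0"
proof -
  have fin: "finite (\<sigma> ` {0..1})" using simple_functionD(1)[OF \<sigma>] by simp
  have "AE x in unit_lebesgue. x \<in> fibre \<sigma> i \<longrightarrow> measure unit_lebesgue (fibre \<sigma> i) \<noteq> 0" for i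
  proof (cases "measure unit_lebesgue (fibre \<sigma> i) = 0")
    case True
    then have "fibre \<sigma> i \<in> null_sets unit_lebesgue"
      using sets_fibre[OF \<sigma>, of i] by (auto simp: null_sets_def unit_lebesgue.emeasure_eq_measure)
    then have "AE x in unit_lebesgue. x \<notin> fibre \<sigma> i" by (rule AE_not_in)
    then show ?thesis by eventually_elim auto
  qed simp
  then have "AE x in unit_lebesgue. \<forall>i\<in>\<sigma> ` {0..1}. x \<in> fibre \<sigma> i \<longrightarrow> measure unit_lebesgue (fibre \<sigma> i) \<noteq> 0"
    using fin by (subst AE_finite_all) auto
  then show ?thesis
    by (rule AE_mp) (auto intro!: AE_I2 simp: fibre_def)
qed

lemma simple_comp_measurable:
  "simple_function M \<sigma> \<Longrightarrow> (\<lambda>x. c (\<sigma> x)) \<in> borel_measurable M" for c :: "_ \<Rightarrow> real"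
  using borel_measurable_simple_function[OF simple_function_compose1, of M \<sigma> c] by simp

lemma integral_powr_step:
  assumes \<sigma>: "simple_function unit_lebesgue \<sigma>" and m: "\<sigma> ` {0..1} \<subseteq> {..<m}"
  shows "integrable unit_lebesgue (\<lambda>x. \<bar>c (\<sigma> x)\<bar> powr q)"
    and "(\<integral>x. \<bar>c (\<sigma> x)\<bar> powr q \<partial>unit_lebesgue) = (\<Sum>i<m. measure unit_lebesgue (fibre \<sigma> i) * \<bar>c i\<bar> powr q)"
proof -
  have eq: "\<bar>c (\<sigma> x)\<bar> powr q = (\<Sum>i<m. indicator (fibre \<sigma> i) x * \<bar>c i\<bar> powr q)" if "x \<in> space unit_lebesgue" for x
  proof -
    have "\<sigma> x < m" using that imageI[of x "{0..1}" \<sigma>] m by fastforce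
    have "(\<Sum>i<m. indicator (fibre \<sigma> i) x * \<bar>c i\<bar> powr q) = (\<Sum>i<m. if i = \<sigma> x then \<bar>c i\<bar> powr q else 0)"
      using that by (intro sum.cong) (auto simp: fibre_def indicator_def)
    also have "\<dots> = \<bar>c (\<sigma> x)\<bar> powr q" using \<open>\<sigma> x < m\<close> by (subst sum.delta) auto
    finally show ?thesis by simp
  qed
  have i: "integrable unit_lebesgue (\<lambda>x. indicator (fibre \<sigma> i) x * \<bar>c i\<bar> powr q)" for i
    using sets_fibre[OF \<sigma>, of i] by (intro integrable_indicator_mult unit_lebesgue.integrable_const)
  have "integrable unit_lebesgue (\<lambda>x. \<bar>c (\<sigma> x)\<bar> powr q) \<longleftrightarrow> integrable unit_lebesgue (\<lambda>x. \<Sum>i<m. indicator (fibre \<sigma> i) x * \<bar>c i\<bar> powr q)"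
    by (intro Bochner_Integration.integrable_cong refl eq)
  then show "integrable unit_lebesgue (\<lambda>x. \<bar>c (\<sigma> x)\<bar> powr q)"
    by (rule iffD2) (intro Bochner_Integration.integrable_sum i)
  have "(\<integral>x. \<bar>c (\<sigma> x)\<bar> powr q \<partial>unit_lebesgue) = (\<integral>x. (\<Sum>i<m. indicator (fibre \<sigma> i) x * \<bar>c i\<bar> powr q) \<partial>unit_lebesgue)"
    by (intro Bochner_Integration.integral_cong refl eq)
  also have "\<dots> = (\<Sum>i<m. (\<integral>x. indicator (fibre \<sigma> i) x * \<bar>c i\<bar> powr q \<partial>unit_lebesgue))"
    by (intro Bochner_Integration.integral_sum i)
  also have "\<dots> = (\<Sum>i<m. measure unit_lebesgue (fibre \<sigma> i) * \<bar>c i\<bar> powr q)"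
    using sets.sets_into_space[OF sets_fibre[OF \<sigma>]] by (intro sum.cong) (auto simp: Int_absorb2)
  finally show "(\<integral>x. \<bar>c (\<sigma> x)\<bar> powr q \<partial>unit_lebesgue) = (\<Sum>i<m. measure unit_lebesgue (fibre \<sigma> i) * \<bar>c i\<bar> powr q)" .
qed

lemma Lp_step:
  assumes p: "1 \<le> p" and \<sigma>: "simple_function unit_lebesgue \<sigma>"
  shows "(\<lambda>x. c (\<sigma> x :: nat)) \<in> Lp_functions p"
proof -
  have fin: "finite (\<sigma> ` {0..1})" using simple_functionD(1)[OF \<sigma>] by simp
  show ?thesis
  proof (cases "p = top")
    case True
    have "AE x in unit_lebesgue. \<bar>c (\<sigma> x)\<bar> \<le> Max ((\<lambda>i. \<bar>c i\<bar>) ` \<sigma> ` {0..1})"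
      using fin by (intro AE_I2 Max_ge) auto
    then show ?thesis
      using Lp_norm_top_leI(1)[OF simple_comp_measurable[OF \<sigma>, of c]] True by blast
  next
    case False
    from fin obtain m where "\<sigma> ` {0..1} \<subseteq> {..<m}" using finite_nat_iff_bounded by blast
    then show ?thesis
      using False integral_powr_step(1)[OF \<sigma>, of m c] simple_comp_measurable[OF \<sigma>, of c]
      by (simp add: Lp_functions_def)
  qed
qed

text \<open>For \<open>p = top\<close> the weight is the indicator of the non-null fibres, since \<open>0 powr 0 = 0\<close>.\<close>

definition fibre_weight :: "ennreal \<Rightarrow> (real \<Rightarrow> nat) \<Rightarrow> nat \<Rightarrow> real" where
  "fibre_weight p \<sigma> i = measure unit_lebesgue (fibre \<sigma> i) powr (if p = top then 0 else 1 / enn2real p)"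

text \<open>For a finite exponent the integral is a sum of powers of \<open>\<bar>c i\<bar>\<close>
  times fibre measures, which the weights absorb; for \<open>p = top\<close> the essential supremum
  is a maximum over the non-null fibres.\<close>

lemma Lp_norm_step:
  assumes p: "1 \<le> p" and \<sigma>: "simple_function unit_lebesgue \<sigma>" and m: "\<sigma> ` {0..1} \<subseteq> {..<m}"
  shows "Lp_norm p (\<lambda>x. c (\<sigma> x)) = ell_norm p m (\<lambda>i. fibre_weight p \<sigma> i * c i)"
proof (cases "p = top")
  case True
  have "0 < m" using m by (cases m) auto
  then have m1: "1 \<le> m" by simp
  have L: "(\<lambda>x. c (\<sigma> x)) \<in> Lp_functions top" using Lp_step[OF p \<sigma>] True by simp
  show ?thesis unfolding True
  proof (rule antisym)
    have "AE x in unit_lebesgue. \<bar>c (\<sigma> x)\<bar> \<le> ell_norm top m (\<lambda>i. fibre_weight top \<sigma> i * c i)"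
    proof (rule AE_mp[OF AE_fibre_nonnull[OF \<sigma>]], intro AE_I2 impI)
      fix x assume x: "x \<in> space unit_lebesgue" "measure unit_lebesgue (fibre \<sigma> (\<sigma> x)) \<noteq> 0"
      then have xm: "\<sigma> x < m" using imageI[of x "{0..1}" \<sigma>] m by fastforce
      have "\<bar>c (\<sigma> x)\<bar> = \<bar>fibre_weight top \<sigma> (\<sigma> x) * c (\<sigma> x)\<bar>"
        using x by (simp add: fibre_weight_def)
      also have "\<dots> \<le> ell_norm top m (\<lambda>i. fibre_weight top \<sigma> i * c i)"
        using xm by (intro coord_le_ell_norm[where v = "\<lambda>i. fibre_weight top \<sigma> i * c i"]) auto
      finally show "\<bar>c (\<sigma> x)\<bar> \<le> ell_norm top m (\<lambda>i. fibre_weight top \<sigma> i * c i)" .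
    qed
    then show "Lp_norm top (\<lambda>x. c (\<sigma> x)) \<le> ell_norm top m (\<lambda>i. fibre_weight top \<sigma> i * c i)"
      by (intro Lp_norm_top_leI(2) simple_comp_measurable \<sigma>)
    have "\<bar>fibre_weight top \<sigma> i * c i\<bar> \<le> Lp_norm top (\<lambda>x. c (\<sigma> x))" if "i < m" for i
    proof (cases "measure unit_lebesgue (fibre \<sigma> i) = 0")
      case True
      then show ?thesis by (simp add: fibre_weight_def Lp_norm_nonneg)
    next
      case False
      \<comment> \<open>A value exceeding the essential supremum could only be taken on a null
        fibre.\<close>
      have "\<bar>c i\<bar> \<le> Lp_norm top (\<lambda>x. c (\<sigma> x))"
      proof (rule ccontr)
        assume *: "\<not> ?thesis"
        have "AE x in unit_lebesgue. x \<notin> fibre \<sigma> i"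
          using Lp_norm_top_bound[OF L] by eventually_elim (use * in \<open>auto simp: fibre_def\<close>)
        then have "fibre \<sigma> i \<in> null_sets unit_lebesgue"
          using AE_iff_null_sets[OF sets_fibre[OF \<sigma>]] by blast
        then show False using False by (simp add: null_sets_def measure_def)
      qed
      then show ?thesis using False by (simp add: fibre_weight_def)
    qed
    then show "ell_norm top m (\<lambda>i. fibre_weight top \<sigma> i * c i) \<le> Lp_norm top (\<lambda>x. c (\<sigma> x))"
      using m1 by (subst ell_norm_top_le_iff) auto
  qed
next
  case False
  have q: "1 \<le> enn2real p" using finite_exponent p False by blast
  show ?thesis
    using False q integral_powr_step(2)[OF \<sigma> m, of c "enn2real p"]
    by (simp add: Lp_norm_def ell_norm_def fibre_weight_def abs_mult powr_mult powr_powr)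
qed

text \<open>A convex function lies above its tangents. Convexity is used on the open half-line, so
  \<open>t = 0\<close> is computed directly.\<close>

lemma powr_ge_tangent:
  fixes q a t :: real
  assumes "1 \<le> q" "0 < a" "0 \<le> t"
  shows "a powr q + q * a powr (q - 1) * (t - a) \<le> t powr q"
proof (cases "t = 0")
  case True
  have "a powr q = a powr (q - 1) * a" using assms powr_mult_base[of a "q - 1"] by (simp add: mult.commute)
  then have "a powr q + q * a powr (q - 1) * (0 - a) = (1 - q) * a powr q" by (simp add: algebra_simps)
  also have "\<dots> \<le> 0" using assms by (intro mult_nonpos_nonneg) auto
  finally show ?thesis using True by simp
next
  case False
  have "convex_on {0<..} (\<lambda>x::real. x powr q)"
  proof (rule f''_ge0_imp_convex)
    show "DERIV (\<lambda>x::real. x powr q) x :> q * x powr (q - 1)" if "x \<in> {0<..}" for x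
      using that by (intro has_real_derivative_powr) auto
    show "DERIV (\<lambda>x::real. q * x powr (q - 1)) x :> q * ((q - 1) * x powr (q - 1 - 1))"
      if "x \<in> {0<..}" for x
      using that by (intro DERIV_cmult has_real_derivative_powr) auto
  qed (use assms in auto)
  then have "t powr q - a powr q \<ge> q * a powr (q - 1) * (t - a)"
    using assms False
    by (intro convex_on_imp_above_tangent[where A = "{0<..}"])
      (auto intro!: has_field_derivative_at_within has_real_derivative_powr simp: interior_open)
  then show ?thesis by simp
qed

text \<open>Jensen's inequality on one fibre: the tangent inequality at the modulus of the average
  is integrated over the fibre.\<close>

lemma fibre_avg_powr_le:
  assumes \<sigma>: "simple_function unit_lebesgue \<sigma>" and q: "1 \<le> q"
    and v: "integrable unit_lebesgue v" "integrable unit_lebesgue (\<lambda>x. \<bar>v x\<bar> powr q)"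
  shows "measure unit_lebesgue (fibre \<sigma> i) * \<bar>fibre_avg \<sigma> v i\<bar> powr q
    \<le> (\<integral>x. indicator (fibre \<sigma> i) x * \<bar>v x\<bar> powr q \<partial>unit_lebesgue)"
proof -
  let ?A = "fibre \<sigma> i" and ?a = "\<bar>fibre_avg \<sigma> v i\<bar>" and ?\<mu> = "measure unit_lebesgue (fibre \<sigma> i)"
  note A = sets_fibre[OF \<sigma>, of i]
  have A': "?A \<inter> space unit_lebesgue = ?A" using sets.sets_into_space[OF A] by (rule Int_absorb2)
  note ind = integrable_indicator_mult[OF A]
  show ?thesis
  proof (cases "?a = 0 \<or> ?\<mu> = 0")
    case True
    then show ?thesis using q by (auto intro!: integral_nonneg_AE)
  next
    case False
    then have a: "0 < ?a" and \<mu>: "0 < ?\<mu>" by (auto simp: zero_less_measure_iff less_le)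
    let ?k = "q * ?a powr (q - 1)"
    have abs: "?\<mu> * ?a \<le> (\<integral>x. indicator ?A x * \<bar>v x\<bar> \<partial>unit_lebesgue)"
    proof -
      have "?\<mu> * ?a = \<bar>\<integral>x. indicator ?A x * v x \<partial>unit_lebesgue\<bar>"
        using \<mu> by (simp add: fibre_avg_def)
      also have "\<dots> \<le> (\<integral>x. \<bar>indicator ?A x * v x\<bar> \<partial>unit_lebesgue)" by (rule integral_abs_bound)
      also have "\<dots> = (\<integral>x. indicator ?A x * \<bar>v x\<bar> \<partial>unit_lebesgue)" by (simp add: abs_mult)
      finally show ?thesis .
    qed
    \<comment> \<open>The right-hand side is the integral of the tangent at \<open>?a\<close> over
      the fibre; \<open>abs\<close> bounds it from below because the slope \<open>?k\<close> is
      nonnegative.\<close>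
    have "?\<mu> * ?a powr q \<le> ?\<mu> * (?a powr q - ?k * ?a) + ?k * (\<integral>x. indicator ?A x * \<bar>v x\<bar> \<partial>unit_lebesgue)"
      using mult_left_mono[OF abs, of ?k] q by (simp add: algebra_simps)
    also have "\<dots> = (\<integral>x. indicator ?A x * (?a powr q - ?k * ?a) + ?k * (indicator ?A x * \<bar>v x\<bar>) \<partial>unit_lebesgue)"
      using ind[OF integrable_abs[OF v(1)]] ind[OF unit_lebesgue.integrable_const[of "?a powr q - ?k * ?a"]] A'
      by (subst Bochner_Integration.integral_add) auto
    also have "\<dots> \<le> (\<integral>x. indicator ?A x * \<bar>v x\<bar> powr q \<partial>unit_lebesgue)"
    proof (rule integral_mono)
      show "integrable unit_lebesgue (\<lambda>x. indicator ?A x * (?a powr q - ?k * ?a) + ?k * (indicator ?A x * \<bar>v x\<bar>))"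
        by (intro Bochner_Integration.integrable_add integrable_mult_right ind integrable_abs v unit_lebesgue.integrable_const)
      show "integrable unit_lebesgue (\<lambda>x. indicator ?A x * \<bar>v x\<bar> powr q)" by (intro ind v)
      show "indicator ?A x * (?a powr q - ?k * ?a) + ?k * (indicator ?A x * \<bar>v x\<bar>) \<le> indicator ?A x * \<bar>v x\<bar> powr q" for x
        using powr_ge_tangent[OF q a, of "\<bar>v x\<bar>"] by (simp add: indicator_def algebra_simps)
    qed
    finally show ?thesis .
  qed
qed

text \<open>Conditional expectation is a contraction: for finite exponents Jensen's inequality is
  summed over the fibres, and for \<open>p = top\<close> averages cannot exceed the essential
  bound.\<close>

lemma Lp_norm_fibre_avg_le:
  assumes p: "1 \<le> p" and \<sigma>: "simple_function unit_lebesgue \<sigma>" and v: "v \<in> Lp_functions p"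
  shows "Lp_norm p (\<lambda>x. fibre_avg \<sigma> v (\<sigma> x)) \<le> Lp_norm p v"
proof -
  have i: "integrable unit_lebesgue v" by (rule Lp_integrable[OF p v])
  note ind = integrable_indicator_mult[OF sets_fibre[OF \<sigma>]]
  show ?thesis
  proof (cases "p = top")
    case True
    let ?N = "Lp_norm top v"
    have "\<bar>fibre_avg \<sigma> v i\<bar> \<le> ?N" for i
    proof (cases "measure unit_lebesgue (fibre \<sigma> i) = 0")
      case True
      then show ?thesis by (simp add: fibre_avg_def Lp_norm_nonneg)
    next
      case False
      have "\<bar>\<integral>x. indicator (fibre \<sigma> i) x * v x \<partial>unit_lebesgue\<bar>
          \<le> (\<integral>x. \<bar>indicator (fibre \<sigma> i) x * v x\<bar> \<partial>unit_lebesgue)" by (rule integral_abs_bound)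
      also have "\<dots> \<le> (\<integral>x. indicator (fibre \<sigma> i) x * ?N \<partial>unit_lebesgue)"
      proof (rule integral_mono_AE)
        show "AE x in unit_lebesgue. \<bar>indicator (fibre \<sigma> i) x * v x\<bar> \<le> indicator (fibre \<sigma> i) x * ?N"
          using Lp_norm_top_bound[OF v[unfolded True]] by eventually_elim (simp add: indicator_def)
      qed (intro integrable_abs ind i unit_lebesgue.integrable_const)+
      also have "\<dots> = ?N * measure unit_lebesgue (fibre \<sigma> i)"
        using sets.sets_into_space[OF sets_fibre[OF \<sigma>]] by (simp add: Int_absorb2)
      finally show ?thesis using False
        by (simp add: fibre_avg_def abs_divide divide_le_eq zero_less_measure_iff less_le)
    qed
    then show ?thesis unfolding True
      by (intro Lp_norm_top_leI(2) simple_comp_measurable \<sigma> AE_I2)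
  next
    case False
    let ?q = "enn2real p"
    have q: "1 \<le> ?q" using finite_exponent p False by blast
    have vq: "integrable unit_lebesgue (\<lambda>x. \<bar>v x\<bar> powr ?q)"
      using v False by (simp add: Lp_functions_def)
    have "finite (\<sigma> ` {0..1})" using simple_functionD(1)[OF \<sigma>] by simp
    then obtain m where m: "\<sigma> ` {0..1} \<subseteq> {..<m}" using finite_nat_iff_bounded by blast
    have "(\<integral>x. \<bar>fibre_avg \<sigma> v (\<sigma> x)\<bar> powr ?q \<partial>unit_lebesgue)
        = (\<Sum>i<m. measure unit_lebesgue (fibre \<sigma> i) * \<bar>fibre_avg \<sigma> v i\<bar> powr ?q)"
      by (rule integral_powr_step(2)[OF \<sigma> m])
    also have "\<dots> \<le> (\<Sum>i<m. (\<integral>x. indicator (fibre \<sigma> i) x * \<bar>v x\<bar> powr ?q \<partial>unit_lebesgue))"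
      by (intro sum_mono fibre_avg_powr_le \<sigma> q i vq)
    also have "\<dots> = (\<integral>x. (\<Sum>i<m. indicator (fibre \<sigma> i) x * \<bar>v x\<bar> powr ?q) \<partial>unit_lebesgue)"
      by (intro Bochner_Integration.integral_sum[symmetric] ind vq)
    also have "\<dots> = (\<integral>x. \<bar>v x\<bar> powr ?q \<partial>unit_lebesgue)"
    proof (intro Bochner_Integration.integral_cong refl)
      fix x assume x: "x \<in> space unit_lebesgue"
      have "\<sigma> x < m" using x imageI[of x "{0..1}" \<sigma>] m by fastforce
      have "(\<Sum>i<m. indicator (fibre \<sigma> i) x * \<bar>v x\<bar> powr ?q) = (\<Sum>i<m. if i = \<sigma> x then \<bar>v x\<bar> powr ?q else 0)"
        using x by (intro sum.cong) (auto simp: fibre_def indicator_def)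
      also have "\<dots> = \<bar>v x\<bar> powr ?q" using \<open>\<sigma> x < m\<close> by (subst sum.delta) auto
      finally show "(\<Sum>i<m. indicator (fibre \<sigma> i) x * \<bar>v x\<bar> powr ?q) = \<bar>v x\<bar> powr ?q" .
    qed
    also have "\<dots> = Lp_norm p v powr ?q" by (rule Lp_norm_powr[OF p False])
    finally show ?thesis by (intro Lp_norm_leI p False Lp_norm_nonneg)
  qed
qed

text \<open>Density of simple functions. For \<open>p = top\<close> the values are rounded down to
  multiples of \<open>\<epsilon>\<close>; otherwise pointwise approximation is upgraded by dominated
  convergence.\<close>

lemma Lp_step_approx:
  assumes p: "1 \<le> p" and v: "v \<in> Lp_functions p" and \<epsilon>: "0 < \<epsilon>"
  shows "\<exists>s. simple_function unit_lebesgue s \<and> Lp_norm p (\<lambda>x. v x - s x) \<le> \<epsilon>"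
proof -
  have m [measurable]: "v \<in> borel_measurable unit_lebesgue" using v by (simp add: Lp_functions_def)
  show ?thesis
  proof (cases "p = top")
    case True
    let ?N = "Lp_norm top v"
    \<comment> \<open>Values beyond the essential bound occur on a null set only; replacing them by
      zero leaves finitely many rounded values.\<close>
    define s where "s x = (if \<bar>v x\<bar> \<le> ?N then \<epsilon> * of_int \<lfloor>v x / \<epsilon>\<rfloor> else 0)" for x
    have "s ` space unit_lebesgue \<subseteq> insert 0 ((\<lambda>k. \<epsilon> * of_int k) ` {\<lfloor>- ?N / \<epsilon>\<rfloor>..\<lfloor>?N / \<epsilon>\<rfloor>})"
    proof safe
      fix x assume nz: "s x \<notin> (\<lambda>k. \<epsilon> * of_int k) ` {\<lfloor>- ?N / \<epsilon>\<rfloor>..\<lfloor>?N / \<epsilon>\<rfloor>}"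
      show "s x = 0"
      proof (rule ccontr)
        assume "s x \<noteq> 0"
        then have x: "\<bar>v x\<bar> \<le> ?N" "s x = \<epsilon> * of_int \<lfloor>v x / \<epsilon>\<rfloor>" by (auto simp: s_def split: if_splits)
        have "- ?N / \<epsilon> \<le> v x / \<epsilon>" "v x / \<epsilon> \<le> ?N / \<epsilon>"
          using x(1) \<epsilon> divide_right_mono[of "- ?N" "v x" \<epsilon>] by (auto intro!: divide_right_mono)
        then have "\<lfloor>v x / \<epsilon>\<rfloor> \<in> {\<lfloor>- ?N / \<epsilon>\<rfloor>..\<lfloor>?N / \<epsilon>\<rfloor>}" unfolding atLeastAtMost_iff by (intro conjI floor_mono)
        then show False using nz x(2) by blast
      qed
    qed
    then have fin: "finite (s ` space unit_lebesgue)" by (rule finite_subset) simp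
    have sm: "s \<in> borel_measurable unit_lebesgue" unfolding s_def by measurable
    have "AE x in unit_lebesgue. \<bar>v x - s x\<bar> \<le> \<epsilon>"
      using Lp_norm_top_bound[OF v[unfolded True]]
    proof eventually_elim
      case (elim x)
      have "\<bar>v x - s x\<bar> = \<epsilon> * \<bar>v x / \<epsilon> - of_int \<lfloor>v x / \<epsilon>\<rfloor>\<bar>"
        using elim \<epsilon> unfolding s_def abs_mult_pos[OF less_imp_le[OF \<epsilon>], symmetric]
        by (simp add: field_simps)
      also have "\<dots> \<le> \<epsilon> * 1" using \<epsilon> by (intro mult_left_mono) linarith+
      finally show ?case by simp
    qed
    then have "Lp_norm p (\<lambda>x. v x - s x) \<le> \<epsilon>"
      unfolding True using sm by (intro Lp_norm_top_leI(2)) measurable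
    then show ?thesis using simple_function_borel_measurable[OF sm fin] by blast
  next
    case False
    let ?q = "enn2real p"
    have q: "1 \<le> ?q" using finite_exponent p False by blast
    have vq: "integrable unit_lebesgue (\<lambda>x. \<bar>v x\<bar> powr ?q)"
      using v False by (simp add: Lp_functions_def)
    obtain F where F': "\<forall>i. simple_function unit_lebesgue (F i)"
      and lim': "\<forall>x\<in>space unit_lebesgue. (\<lambda>i. F i x) \<longlonglongrightarrow> v x"
      and bnd': "\<forall>i. \<forall>x\<in>space unit_lebesgue. dist (F i x) 0 \<le> 2 * dist (v x) 0"
      using borel_measurable_implies_sequence_metric[OF m, of 0] by (elim exE conjE)
    have F: "simple_function unit_lebesgue (F i)" for i using F' by (rule spec)
    have lim: "(\<lambda>i. F i x) \<longlonglongrightarrow> v x" if "x \<in> space unit_lebesgue" for x using lim' that by (rule bspec)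
    have bnd: "\<bar>F i x\<bar> \<le> 2 * \<bar>v x\<bar>" if "x \<in> space unit_lebesgue" for i x
      using bspec[OF spec[OF bnd', of i] that] by (simp add: dist_real_def)
    have Fm [measurable]: "F i \<in> borel_measurable unit_lebesgue" for i
      using F by (rule borel_measurable_simple_function)
    have "(\<lambda>i. \<integral>x. \<bar>v x - F i x\<bar> powr ?q \<partial>unit_lebesgue) \<longlonglongrightarrow> (\<integral>x. 0 \<partial>unit_lebesgue)"
    proof (rule integral_dominated_convergence)
      \<comment> \<open>The factor three arises because \<open>\<bar>F i x\<bar>\<close> is at most
        twice \<open>\<bar>v x\<bar>\<close>.\<close>
      show "integrable unit_lebesgue (\<lambda>x. 3 powr ?q * \<bar>v x\<bar> powr ?q)" using vq by simp
      show "AE x in unit_lebesgue. (\<lambda>i. \<bar>v x - F i x\<bar> powr ?q) \<longlonglongrightarrow> 0"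
      proof (rule AE_I2)
        fix x assume x: "x \<in> space unit_lebesgue"
        have "(\<lambda>i. \<bar>v x - F i x\<bar>) \<longlonglongrightarrow> \<bar>v x - v x\<bar>"
          by (intro tendsto_intros lim x)
        then show "(\<lambda>i. \<bar>v x - F i x\<bar> powr ?q) \<longlonglongrightarrow> 0"
          using q by (intro tendsto_zero_powrI[OF _ tendsto_const]) auto
      qed
      show "AE x in unit_lebesgue. norm (\<bar>v x - F i x\<bar> powr ?q) \<le> 3 powr ?q * \<bar>v x\<bar> powr ?q" for i
      proof (rule AE_I2)
        fix x assume x: "x \<in> space unit_lebesgue"
        have "\<bar>v x - F i x\<bar> powr ?q \<le> (3 * \<bar>v x\<bar>) powr ?q"
          using bnd[OF x, of i] q by (intro powr_mono2) auto
        then show "norm (\<bar>v x - F i x\<bar> powr ?q) \<le> 3 powr ?q * \<bar>v x\<bar> powr ?q" by (simp add: powr_mult)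
      qed
    qed measurable
    then have "\<forall>\<^sub>F i in sequentially. (\<integral>x. \<bar>v x - F i x\<bar> powr ?q \<partial>unit_lebesgue) < \<epsilon> powr ?q"
      using \<epsilon> by (intro order_tendstoD(2)) auto
    then obtain i where "(\<integral>x. \<bar>v x - F i x\<bar> powr ?q \<partial>unit_lebesgue) < \<epsilon> powr ?q"
      by (auto simp: eventually_sequentially)
    then have "Lp_norm p (\<lambda>x. v x - F i x) \<le> \<epsilon>" using \<epsilon> by (intro Lp_norm_leI p False) auto
    then show ?thesis using F by blast
  qed
qed

text \<open>One partition serves all functions: labels of the old partition are paired with a
  numbering of the values of a new approximant, so every approximant is a function of the refined
  label.\<close>

lemma Lp_step_approx_finite:
  assumes p: "1 \<le> p" and Z: "finite Z" "Z \<subseteq> Lp_functions p" and \<epsilon>: "0 < \<epsilon>"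
  shows "\<exists>\<sigma>. simple_function unit_lebesgue \<sigma> \<and>
    (\<forall>z\<in>Z. \<exists>c. Lp_norm p (\<lambda>x. z x - c (\<sigma> x :: nat)) \<le> \<epsilon>)"
  using Z
proof (induction Z rule: finite_induct)
  case empty
  then show ?case by (intro exI[of _ "\<lambda>_. 0"]) simp
next
  case (insert v Z)
  then obtain \<sigma> where \<sigma>: "simple_function unit_lebesgue \<sigma>"
    "\<And>z. z \<in> Z \<Longrightarrow> \<exists>c. Lp_norm p (\<lambda>x. z x - c (\<sigma> x :: nat)) \<le> \<epsilon>" by auto
  obtain s where s: "simple_function unit_lebesgue s" "Lp_norm p (\<lambda>x. v x - s x) \<le> \<epsilon>"
    using Lp_step_approx[OF p _ \<epsilon>, of v] insert.prems by auto
  have "finite (s ` {0..1})" using simple_functionD(1)[OF s(1)] by simp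
  from finite_imp_inj_to_nat_seg[OF this] obtain h :: "real \<Rightarrow> nat" where h: "inj_on h (s ` {0..1})" by blast
  define \<tau> where "\<tau> x = prod_encode (\<sigma> x, h (s x))" for x
  have "simple_function unit_lebesgue (\<lambda>x. (\<sigma> x, h (s x)))"
    by (intro simple_function_Pair \<sigma> simple_function_compose1[OF s(1)])
  then have \<tau>: "simple_function unit_lebesgue \<tau>"
    unfolding \<tau>_def by (rule simple_function_compose1)
  have "\<exists>c. Lp_norm p (\<lambda>x. z x - c (\<tau> x)) \<le> \<epsilon>" if "z \<in> Z" for z
  proof -
    from \<sigma>(2)[OF that] obtain c where "Lp_norm p (\<lambda>x. z x - c (\<sigma> x)) \<le> \<epsilon>" by blast
    then show ?thesis by (intro exI[of _ "\<lambda>k. c (fst (prod_decode k))"]) (simp add: \<tau>_def)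
  qed
  moreover have "\<exists>c. Lp_norm p (\<lambda>x. v x - c (\<tau> x)) \<le> \<epsilon>"
  proof -
    \<comment> \<open>Decoding recovers \<open>s\<close> at points of the unit interval, so the
      norms are compared through almost-everywhere equality.\<close>
    define c where "c k = inv_into (s ` {0..1}) h (snd (prod_decode k))" for k
    have v: "v \<in> Lp_functions p" using insert.prems by simp
    have eq: "c (\<tau> x) = s x" if "x \<in> {0..1}" for x
      using h that by (simp add: c_def \<tau>_def)
    have ae: "AE x in unit_lebesgue. v x - c (\<tau> x) = v x - s x" by (rule AE_I2) (simp add: eq)
    have c: "(\<lambda>x. v x - c (\<tau> x)) \<in> Lp_functions p" by (intro Lp_diff p v Lp_step \<tau>)
    have "(\<lambda>x. v x - s x) \<in> Lp_functions p"
    proof -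
      have "(\<lambda>x. v x - s x) \<in> borel_measurable unit_lebesgue"
        using v borel_measurable_simple_function[OF s(1)] by (auto simp: Lp_functions_def)
      then show ?thesis
        by (rule Lp_functions_cong_AE[OF p c _ ae])
    qed
    from Lp_norm_cong_AE[OF p c this ae] s(2) show ?thesis by (intro exI[of _ c]) simp
  qed
  ultimately show ?case using \<tau> by (intro exI[of _ \<tau>]) auto
qed

text \<open>The coordinates of \<open>S x\<close> are the averages of \<open>x\<close> over the fibres of a step function that
  approximates a finite net of \<open>X\<close>, weighted so that the step function of these averages has
  \<open>p\<close>-norm \<open>ell_norm p m (S x)\<close>.\<close>

lemma Lp_almost_isometry_on_totally_bounded:
  assumes p: "1 \<le> p" and X: "X \<subseteq> Lp_functions p" and \<epsilon>: "0 < \<epsilon>"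
    and net: "\<And>\<delta>. 0 < \<delta> \<Longrightarrow> \<exists>Z. finite Z \<and> Z \<subseteq> Lp_functions p \<and> (\<forall>x\<in>X. \<exists>z\<in>Z. Lp_norm p (\<lambda>t. x t - z t) \<le> \<delta>)"
  shows "\<exists>m\<ge>1. \<exists>S::(real \<Rightarrow> real) \<Rightarrow> nat \<Rightarrow> real.
    (\<forall>x\<in>Lp_functions p. \<forall>y\<in>Lp_functions p. \<forall>a b.
      ell_norm p m (\<lambda>i. a * S x i + b * S y i) \<le> Lp_norm p (\<lambda>t. a * x t + b * y t)) \<and>
    (\<forall>x\<in>X. \<forall>y\<in>X. \<forall>a b. \<bar>a\<bar> \<le> 1 \<longrightarrow> \<bar>b\<bar> \<le> 1 \<longrightarrow>
      Lp_norm p (\<lambda>t. a * x t + b * y t) \<le> ell_norm p m (\<lambda>i. a * S x i + b * S y i) + \<epsilon>)"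
proof -
  \<comment> \<open>Budget: \<open>\<epsilon> / 8\<close> each for the net and for the step function
    puts \<open>x\<close> within \<open>\<epsilon> / 4\<close> of a step function; passing to the
    average of \<open>x\<close> doubles this, and two points together cost
    \<open>\<epsilon>\<close>.\<close>
  obtain Z where Z: "finite Z" "Z \<subseteq> Lp_functions p" "\<And>x. x \<in> X \<Longrightarrow> \<exists>z\<in>Z. Lp_norm p (\<lambda>t. x t - z t) \<le> \<epsilon> / 8"
    using net[of "\<epsilon> / 8"] \<epsilon> by auto
  obtain \<sigma> where \<sigma>: "simple_function unit_lebesgue \<sigma>"
    "\<And>z. z \<in> Z \<Longrightarrow> \<exists>c. Lp_norm p (\<lambda>x. z x - c (\<sigma> x :: nat)) \<le> \<epsilon> / 8"
    using Lp_step_approx_finite[OF p Z(1,2), of "\<epsilon> / 8"] \<epsilon> by auto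
  have "finite (\<sigma> ` {0..1})" using simple_functionD(1)[OF \<sigma>(1)] by simp
  then obtain m where m: "\<sigma> ` {0..1} \<subseteq> {..<m}" using finite_nat_iff_bounded by blast
  have m1: "1 \<le> m" using m by (cases m) auto
  define E where "E v = (\<lambda>x. fibre_avg \<sigma> v (\<sigma> x))" for v
  define S where "S v i = fibre_weight p \<sigma> i * fibre_avg \<sigma> v i" for v i
  have E: "E v \<in> Lp_functions p" for v unfolding E_def by (rule Lp_step[OF p \<sigma>(1)])
  have Elin: "E (\<lambda>t. a * x t + b * y t) = (\<lambda>t. a * E x t + b * E y t)"
    if "x \<in> Lp_functions p" "y \<in> Lp_functions p" for a b x y
    unfolding E_def using that by (simp add: fibre_avg_lincomb[OF \<sigma>(1)] Lp_integrable[OF p])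
  have S: "ell_norm p m (\<lambda>i. a * S x i + b * S y i) = Lp_norm p (E (\<lambda>t. a * x t + b * y t))"
    if "x \<in> Lp_functions p" "y \<in> Lp_functions p" for a b x y
    unfolding E_def Lp_norm_step[OF p \<sigma>(1) m] S_def
    using that by (simp add: fibre_avg_lincomb[OF \<sigma>(1)] Lp_integrable[OF p] algebra_simps)
  have close: "Lp_norm p (\<lambda>t. x t - E x t) \<le> \<epsilon> / 2" if x: "x \<in> X" for x
  proof -
    have xL: "x \<in> Lp_functions p" using x X by blast
    from Z(3)[OF x] obtain z where z: "z \<in> Z" "Lp_norm p (\<lambda>t. x t - z t) \<le> \<epsilon> / 8" by blast
    have zL: "z \<in> Lp_functions p" using z Z by blast
    from \<sigma>(2)[OF z(1)] obtain c where c: "Lp_norm p (\<lambda>t. z t - c (\<sigma> t)) \<le> \<epsilon> / 8" by blast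
    have cL: "(\<lambda>t. c (\<sigma> t)) \<in> Lp_functions p" by (rule Lp_step[OF p \<sigma>(1)])
    have xc: "Lp_norm p (\<lambda>t. x t - c (\<sigma> t)) \<le> \<epsilon> / 4"
      using Lp_add(2)[OF p Lp_diff[OF p xL zL] Lp_diff[OF p zL cL]] z c by simp
    \<comment> \<open>Averaging fixes \<open>c (\<sigma> t)\<close> off the null fibres, so up to
      sign the difference to \<open>E x\<close> is the average of an already small function, which
      the contraction property bounds.\<close>
    have ae: "AE t in unit_lebesgue. c (\<sigma> t) - E x t = - E (\<lambda>t. x t - c (\<sigma> t)) t"
      using AE_fibre_nonnull[OF \<sigma>(1)]
    proof eventually_elim
      case (elim t)
      then have "E (\<lambda>t. c (\<sigma> t)) t = c (\<sigma> t)"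
        unfolding E_def by (intro fibre_avg_step sets_fibre \<sigma>)
      then show ?case using fun_cong[OF Elin[OF xL cL, of 1 "- 1"], of t] by simp
    qed
    have "Lp_norm p (\<lambda>t. c (\<sigma> t) - E x t) = Lp_norm p (\<lambda>t. - E (\<lambda>t. x t - c (\<sigma> t)) t)"
      by (rule Lp_norm_cong_AE[OF p _ _ ae]) (auto intro!: Lp_diff p cL E simp: Lp_uminus)
    also have "\<dots> \<le> Lp_norm p (\<lambda>t. x t - c (\<sigma> t))"
      unfolding Lp_uminus E_def by (rule Lp_norm_fibre_avg_le[OF p \<sigma>(1) Lp_diff[OF p xL cL]])
    finally show ?thesis
      using Lp_add(2)[OF p Lp_diff[OF p xL cL] Lp_diff[OF p cL E[of x]]] xc by simp
  qed
  have "ell_norm p m (\<lambda>i. a * S x i + b * S y i) \<le> Lp_norm p (\<lambda>t. a * x t + b * y t)"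
    if "x \<in> Lp_functions p" "y \<in> Lp_functions p" for a b x y
    unfolding S[OF that] unfolding E_def by (intro Lp_norm_fibre_avg_le p \<sigma> Lp_lincomb that)
  moreover have "Lp_norm p (\<lambda>t. a * x t + b * y t) \<le> ell_norm p m (\<lambda>i. a * S x i + b * S y i) + \<epsilon>"
    if x: "x \<in> X" "y \<in> X" and ab: "\<bar>a\<bar> \<le> 1" "\<bar>b\<bar> \<le> 1" for a b x y
  proof -
    have L: "x \<in> Lp_functions p" "y \<in> Lp_functions p" using x X by auto
    note d = Lp_diff[OF p L(1) E[of x]] Lp_diff[OF p L(2) E[of y]]
    \<comment> \<open>The combination splits into its average and the averaging errors of
      \<open>x\<close> and \<open>y\<close>, weighted by coefficients of modulus at most
      one.\<close>
    have "Lp_norm p (\<lambda>t. a * x t + b * y t) \<le> Lp_norm p (E (\<lambda>t. a * x t + b * y t))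
        + Lp_norm p (\<lambda>t. a * (x t - E x t) + b * (y t - E y t))"
      using Lp_add(2)[OF p E[of "\<lambda>t. a * x t + b * y t"] Lp_lincomb(1)[OF p d, of a b]]
      by (simp add: Elin[OF L] algebra_simps)
    moreover have "Lp_norm p (\<lambda>t. a * (x t - E x t) + b * (y t - E y t)) \<le> \<bar>a\<bar> * (\<epsilon> / 2) + \<bar>b\<bar> * (\<epsilon> / 2)"
      using close[OF x(1)] close[OF x(2)]
      by (intro order_trans[OF Lp_lincomb(2)[OF p d]] add_mono mult_left_mono) auto
    moreover have "\<bar>a\<bar> * (\<epsilon> / 2) + \<bar>b\<bar> * (\<epsilon> / 2) \<le> 1 * (\<epsilon> / 2) + 1 * (\<epsilon> / 2)"
      using ab \<epsilon> by (intro add_mono mult_right_mono) auto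
    ultimately show ?thesis using S[OF L] by simp
  qed
  ultimately show ?thesis using m1 by (intro exI[of _ m] exI[of _ S] conjI) auto
qed

subsection \<open>Dyadic partition of unity\<close>

definition ramp :: "nat \<Rightarrow> real \<Rightarrow> real" where
  "ramp n t = min 1 (max 0 (t / 2 ^ n - 1))"

text \<open>Differences of consecutive ramps, so that partial sums telescope; for
  \<open>n > 0\<close> the support lies between \<open>2 ^ (n - 1)\<close> and
  \<open>2 ^ Suc n\<close>.\<close>

definition tent :: "nat \<Rightarrow> real \<Rightarrow> real" where
  "tent n t = (case n of 0 \<Rightarrow> 1 - ramp 0 t | Suc k \<Rightarrow> ramp k t - ramp (Suc k) t)"

lemma ramp_Suc_le: "0 \<le> t \<Longrightarrow> ramp (Suc n) t \<le> ramp n t"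
proof -
  assume "0 \<le> t"
  then have "t / 2 ^ Suc n \<le> t / 2 ^ n" by (intro divide_left_mono) auto
  then show ?thesis unfolding ramp_def by linarith
qed

lemma ramp_eq_0: "t \<le> 2 ^ n \<Longrightarrow> ramp n t = 0"
  by (simp add: ramp_def field_simps)

lemma ramp_eq_1: "2 ^ Suc n \<le> t \<Longrightarrow> ramp n t = 1"
proof -
  assume "2 ^ Suc n \<le> t"
  then have "2 \<le> t / 2 ^ n" by (simp add: le_divide_eq)
  then show ?thesis unfolding ramp_def by linarith
qed

lemma ramp_lipschitz: "\<bar>ramp n s - ramp n t\<bar> \<le> \<bar>s - t\<bar> / 2 ^ n"
proof -
  have "\<bar>ramp n s - ramp n t\<bar> \<le> \<bar>s / 2 ^ n - t / 2 ^ n\<bar>" unfolding ramp_def by linarith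
  also have "\<dots> = \<bar>s - t\<bar> / 2 ^ n" by (simp add: diff_divide_distrib[symmetric] abs_divide)
  finally show ?thesis .
qed

lemma tent_bounds: "0 \<le> t \<Longrightarrow> 0 \<le> tent n t \<and> tent n t \<le> 1"
proof (cases n)
  case (Suc k)
  assume "0 \<le> t"
  then show ?thesis
    using ramp_Suc_le[of t k] Suc by (simp add: tent_def) (auto simp: ramp_def)
qed (simp add: tent_def ramp_def)

lemma tent_nonzero_less: "tent n t \<noteq> 0 \<Longrightarrow> t < 2 ^ Suc n"
proof (rule ccontr)
  assume *: "tent n t \<noteq> 0" "\<not> t < 2 ^ Suc n"
  then have "ramp k t = 1" if "k \<le> n" for k
  proof -
    have "(2::real) ^ Suc k \<le> 2 ^ Suc n" using that by (intro power_increasing) auto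
    with *(2) show ?thesis by (intro ramp_eq_1) linarith
  qed
  with *(1) show False by (auto simp: tent_def split: nat.splits)
qed

lemma tent_Suc_nonzero_greater: "tent (Suc n) t \<noteq> 0 \<Longrightarrow> 2 ^ n < t"
proof (rule ccontr)
  assume *: "tent (Suc n) t \<noteq> 0" "\<not> 2 ^ n < t"
  have "(2::real) ^ n \<le> 2 ^ Suc n" by (intro power_increasing) auto
  with *(2) have "t \<le> 2 ^ n" "t \<le> 2 ^ Suc n" by linarith+
  then have "ramp n t = 0" "ramp (Suc n) t = 0" by (auto intro: ramp_eq_0 simp del: power_Suc)
  with *(1) show False by (simp add: tent_def)
qed

text \<open>The decay \<open>2 ^ n\<close> of the slope compensates the size of the points at which
  the \<open>n\<close>-th weight is nonzero, whose norm is below \<open>2 ^ Suc n\<close>.\<close>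

lemma tent_lipschitz: "\<bar>tent n s - tent n t\<bar> \<le> 4 * \<bar>s - t\<bar> / 2 ^ n"
proof (cases n)
  case 0
  then have "\<bar>tent n s - tent n t\<bar> \<le> \<bar>s - t\<bar>"
    using ramp_lipschitz[of 0 s t] by (simp add: tent_def abs_minus_commute)
  also have "\<dots> \<le> 4 * \<bar>s - t\<bar> / 2 ^ n" using 0 by simp
  finally show ?thesis .
next
  case (Suc k)
  have "\<bar>tent n s - tent n t\<bar> \<le> \<bar>ramp k s - ramp k t\<bar> + \<bar>ramp n s - ramp n t\<bar>"
    using Suc by (simp add: tent_def)
  also have "\<dots> \<le> \<bar>s - t\<bar> / 2 ^ k + \<bar>s - t\<bar> / 2 ^ n" by (intro add_mono ramp_lipschitz)
  also have "\<dots> \<le> 4 * \<bar>s - t\<bar> / 2 ^ n" using Suc by (simp add: field_simps)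
  finally show ?thesis .
qed

lemma sum_tent: "t \<le> 2 ^ N \<Longrightarrow> (\<Sum>n<Suc N. tent n t) = 1"
proof -
  have "(\<Sum>n<Suc N. tent n t) = 1 - ramp N t" for N
    by (induction N) (simp_all add: tent_def)
  then show "t \<le> 2 ^ N \<Longrightarrow> ?thesis" using ramp_eq_0 by simp
qed

text \<open>If \<open>k\<close> is the least index with nonzero weight, then
  \<open>t < 2 ^ Suc k\<close>, whereas a nonzero weight beyond \<open>Suc k\<close> would force
  \<open>t\<close> above that power.\<close>

lemma tent_support: "\<exists>k. {n. tent n t \<noteq> 0} \<subseteq> {k, Suc k}"
proof (cases "\<exists>n. tent n t \<noteq> 0")
  case True
  define k where "k = (LEAST n. tent n t \<noteq> 0)"
  have k: "tent k t \<noteq> 0" unfolding k_def using LeastI_ex[OF True] .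
  have "n \<in> {k, Suc k}" if n: "tent n t \<noteq> 0" for n
  proof (rule ccontr)
    assume *: "n \<notin> {k, Suc k}"
    have "k \<le> n" unfolding k_def using n by (rule Least_le)
    with * obtain i where i: "n = Suc i" "Suc k \<le> i" by (cases n) auto
    then have "(2::real) ^ Suc k \<le> 2 ^ i" by (intro power_increasing) auto
    also have "\<dots> < t" using tent_Suc_nonzero_greater n i by simp
    also have "\<dots> < 2 ^ Suc k" by (rule tent_nonzero_less[OF k])
    finally show False .
  qed
  then show ?thesis by blast
qed auto

section \<open>Splitting \<open>x - y\<close> along the partition of unity\<close>

lemma Lp_norm_sum_le:
  fixes N :: nat
  assumes p: "1 \<le> p" and f: "\<And>n. f n \<in> Lp_functions p"
  shows "(\<lambda>t. \<Sum>n<N. f n t) \<in> Lp_functions p \<and> Lp_norm p (\<lambda>t. \<Sum>n<N. f n t) \<le> (\<Sum>n<N. Lp_norm p (f n))"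
proof (induction N)
  case 0
  have "(\<lambda>t. 0 * f 0 t) \<in> Lp_functions p" "Lp_norm p (\<lambda>t. 0 * f 0 t) \<le> 0"
    using Lp_scale[OF p f[of 0], of 0] by auto
  then show ?case by simp
next
  case (Suc N)
  then show ?case using Lp_add[OF p _ f[of N], of "\<lambda>t. \<Sum>n<N. f n t"] by auto
qed

text \<open>The norm of the \<open>n\<close>-th term in the decomposition of \<open>x - y\<close>
  induced by the partition of unity.\<close>

definition tent_diff :: "ennreal \<Rightarrow> (real \<Rightarrow> real) \<Rightarrow> (real \<Rightarrow> real) \<Rightarrow> nat \<Rightarrow> real" where
  "tent_diff p x y n = Lp_norm p (\<lambda>t. tent n (Lp_norm p x) * x t - tent n (Lp_norm p y) * y t)"

lemma tent_diff_commute: "tent_diff p x y n = tent_diff p y x n"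
  unfolding tent_diff_def
  using Lp_uminus(2)[of p "\<lambda>t. tent n (Lp_norm p x) * x t - tent n (Lp_norm p y) * y t"] by simp

lemma Lp_norm_diff_commute: "Lp_norm p (\<lambda>t. x t - y t) = Lp_norm p (\<lambda>t. y t - x t)"
  using Lp_uminus(2)[of p "\<lambda>t. x t - y t"] by simp

lemma tent_diff_eq_0:
  assumes p: "1 \<le> p" and x: "x \<in> Lp_functions p"
    and z: "tent n (Lp_norm p x) = 0" "tent n (Lp_norm p y) = 0"
  shows "tent_diff p x y n = 0"
  using Lp_scale(2)[OF p x, of 0] Lp_norm_nonneg[of p "\<lambda>_. 0"] z by (simp add: tent_diff_def)

lemma tent_diff_le:
  assumes p: "1 \<le> p" and x: "x \<in> Lp_functions p" and y: "y \<in> Lp_functions p"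
  shows "tent_diff p x y n \<le> 9 * Lp_norm p (\<lambda>t. x t - y t)"
proof -
  \<comment> \<open>Split the term as \<open>?a * (x - y) + (?a - ?b) * y\<close>. The first part
    costs one distance, the second \<open>4 / 2 ^ n * 2 ^ Suc n = 8\<close>, provided that the
    weight of \<open>y\<close> is nonzero; otherwise the roles of \<open>x\<close> and
    \<open>y\<close> are exchanged.\<close>
  have le: "tent_diff p x y n \<le> 9 * Lp_norm p (\<lambda>t. x t - y t)"
    if x: "x \<in> Lp_functions p" and y: "y \<in> Lp_functions p" and nz: "tent n (Lp_norm p y) \<noteq> 0" for x y
  proof -
    let ?d = "Lp_norm p (\<lambda>t. x t - y t)" and ?a = "tent n (Lp_norm p x)" and ?b = "tent n (Lp_norm p y)"
    have "\<bar>Lp_norm p x - Lp_norm p y\<bar> \<le> ?d"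
      using Lp_add(2)[OF p Lp_diff[OF p x y] y] Lp_add(2)[OF p Lp_diff[OF p y x] x]
        Lp_norm_diff_commute[of p x y] by simp
    then have ab: "\<bar>?a - ?b\<bar> \<le> 4 * ?d / 2 ^ n"
      by (intro order_trans[OF tent_lipschitz] divide_right_mono mult_left_mono) auto
    have "tent_diff p x y n = Lp_norm p (\<lambda>t. ?a * (x t - y t) + (?a - ?b) * y t)"
      unfolding tent_diff_def by (rule arg_cong[of _ _ "Lp_norm p"]) (simp add: algebra_simps fun_eq_iff)
    also have "\<dots> \<le> \<bar>?a\<bar> * ?d + \<bar>?a - ?b\<bar> * Lp_norm p y"
      by (rule Lp_lincomb(2)[OF p Lp_diff[OF p x y] y])
    also have "\<dots> \<le> 1 * ?d + (4 * ?d / 2 ^ n) * 2 ^ Suc n"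
      using ab tent_nonzero_less[OF nz] tent_bounds[OF Lp_norm_nonneg[of p x], of n] Lp_norm_nonneg
      by (intro add_mono mult_mono) auto
    finally show ?thesis by simp
  qed
  show ?thesis
    using le[OF x y] le[OF y x] tent_diff_eq_0[OF p x, of n y] Lp_norm_nonneg[of p "\<lambda>t. x t - y t"]
    by (cases "tent n (Lp_norm p x) = 0"; cases "tent n (Lp_norm p y) = 0")
      (auto simp: tent_diff_commute[of p y x] Lp_norm_diff_commute[of p y x])
qed

lemma tent_diff_support:
  assumes p: "1 \<le> p" and x: "x \<in> Lp_functions p"
  obtains J where "finite J" "card J \<le> 4" "\<And>n. n \<notin> J \<Longrightarrow> tent_diff p x y n = 0"
proof
  let ?J = "{n. tent n (Lp_norm p x) \<noteq> 0} \<union> {n. tent n (Lp_norm p y) \<noteq> 0}"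
  from tent_support obtain k l where
    kl: "{n. tent n (Lp_norm p x) \<noteq> 0} \<subseteq> {k, Suc k}" "{n. tent n (Lp_norm p y) \<noteq> 0} \<subseteq> {l, Suc l}" by meson
  then have sub: "?J \<subseteq> {k, Suc k, l, Suc l}" by blast
  then show "finite ?J" by (rule finite_subset) simp
  have "card ?J \<le> card {k, Suc k, l, Suc l}" using sub by (intro card_mono) auto
  also have "\<dots> \<le> 4" by (simp add: card_insert_if)
  finally show "card ?J \<le> 4" .
  show "n \<notin> ?J \<Longrightarrow> tent_diff p x y n = 0" for n using tent_diff_eq_0[OF p x] by auto
qed

text \<open>At most four terms survive, each at most nine times the distance.\<close>

lemma sum_tent_diff_le:
  assumes p: "1 \<le> p" and x: "x \<in> Lp_functions p" and y: "y \<in> Lp_functions p"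
  shows "(\<Sum>n<N. tent_diff p x y n) \<le> 36 * Lp_norm p (\<lambda>t. x t - y t)"
proof -
  obtain J where J: "finite J" "card J \<le> 4" "\<And>n. n \<notin> J \<Longrightarrow> tent_diff p x y n = 0"
    by (rule tent_diff_support[OF p x, where y = y]) blast
  have "(\<Sum>n<N. tent_diff p x y n) \<le> (\<Sum>n\<in>{..<N} \<union> J. tent_diff p x y n)"
    using J by (intro sum_mono2) (auto simp: tent_diff_def Lp_norm_nonneg)
  also have "\<dots> = (\<Sum>n\<in>J. tent_diff p x y n)"
    using J by (intro sum.mono_neutral_right) auto
  also have "\<dots> \<le> (\<Sum>n\<in>J. 9 * Lp_norm p (\<lambda>t. x t - y t))" by (intro sum_mono tent_diff_le p x y)
  also have "\<dots> = real (card J) * (9 * Lp_norm p (\<lambda>t. x t - y t))" by simp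
  also have "\<dots> \<le> 4 * (9 * Lp_norm p (\<lambda>t. x t - y t))"
    using J Lp_norm_nonneg by (intro mult_right_mono) auto
  finally show ?thesis by simp
qed

text \<open>Pigeonhole: the pieces add up to \<open>x - y\<close> and at most four of them are
  nonzero, so one carries a quarter of the norm.\<close>

lemma tent_diff_large:
  assumes p: "1 \<le> p" and x: "x \<in> Lp_functions p" and y: "y \<in> Lp_functions p"
  shows "\<exists>n. Lp_norm p (\<lambda>t. x t - y t) / 4 \<le> tent_diff p x y n"
proof (rule ccontr)
  let ?d = "Lp_norm p (\<lambda>t. x t - y t)" and ?a = "\<lambda>n. tent n (Lp_norm p x)" and ?b = "\<lambda>n. tent n (Lp_norm p y)"
  assume "\<not> ?thesis"
  then have small: "tent_diff p x y n < ?d / 4" for n by (simp add: not_le)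
  obtain J where J: "finite J" "card J \<le> 4" "\<And>n. n \<notin> J \<Longrightarrow> tent_diff p x y n = 0"
    by (rule tent_diff_support[OF p x, where y = y]) blast
  \<comment> \<open>Up to index \<open>N\<close> the weights of both points sum to one, so a finite
    sum already recovers \<open>x - y\<close>.\<close>
  obtain N where N: "max (Lp_norm p x) (Lp_norm p y) < 2 ^ N"
    using real_arch_pow[of 2 "max (Lp_norm p x) (Lp_norm p y)"] by auto
  have dpos: "0 < ?d" using small[of 0] Lp_norm_nonneg[of p] unfolding tent_diff_def
    by (smt (verit) divide_nonpos_pos)
  have f: "(\<lambda>t. ?a n * x t - ?b n * y t) \<in> Lp_functions p" for n
    by (intro Lp_diff p Lp_scale x y)
  have "(\<lambda>t. x t - y t) = (\<lambda>t. \<Sum>n<Suc N. ?a n * x t - ?b n * y t)"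
  proof
    fix t
    have "(\<Sum>n<Suc N. ?a n * x t - ?b n * y t) = (\<Sum>n<Suc N. ?a n) * x t - (\<Sum>n<Suc N. ?b n) * y t"
      by (simp only: sum_subtractf sum_distrib_right)
    then show "x t - y t = (\<Sum>n<Suc N. ?a n * x t - ?b n * y t)"
      using N sum_tent[of "Lp_norm p x" N] sum_tent[of "Lp_norm p y" N] by simp
  qed
  then have "?d \<le> (\<Sum>n<Suc N. tent_diff p x y n)"
    unfolding tent_diff_def
    using Lp_norm_sum_le[OF p, of "\<lambda>n t. ?a n * x t - ?b n * y t" "Suc N", OF f] by simp
  also have "\<dots> \<le> (\<Sum>n\<in>{..<Suc N} \<union> J. tent_diff p x y n)"
    using J by (intro sum_mono2) (auto simp: tent_diff_def Lp_norm_nonneg)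
  also have "\<dots> = (\<Sum>n\<in>J. tent_diff p x y n)"
    using J by (intro sum.mono_neutral_right) auto
  finally have le: "?d \<le> (\<Sum>n\<in>J. tent_diff p x y n)" .
  then have "J \<noteq> {}" using dpos by auto
  then have "(\<Sum>n\<in>J. tent_diff p x y n) < (\<Sum>n\<in>J. ?d / 4)"
    using small J by (intro sum_strict_mono) auto
  also have "\<dots> = real (card J) * (?d / 4)" by simp
  also have "\<dots> \<le> 4 * (?d / 4)" using J dpos by (intro mult_right_mono) auto
  finally show False using le by simp
qed

subsection \<open>Gluing\<close>

text \<open>Both components of a pair are bounded by its code, so the first \<open>K\<close> codes
  lie in a \<open>K\<close> by \<open>K\<close> square; there the sum factors, and the geometric
  part is at most two.\<close>

lemma sum_prod_decode_le:
  fixes w :: "nat \<Rightarrow> real"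
  assumes w: "\<And>n. 0 \<le> w n" "\<And>N. (\<Sum>n<N. w n) \<le> c"
  shows "(\<Sum>k<K. (1 / 2) ^ snd (prod_decode k) * w (fst (prod_decode k))) \<le> 2 * c"
proof -
  let ?g = "\<lambda>(n, j). (1 / 2) ^ j * w n"
  have "(\<Sum>k<K. (1 / 2) ^ snd (prod_decode k) * w (fst (prod_decode k))) = (\<Sum>k<K. ?g (prod_decode k))"
    by (simp add: case_prod_unfold)
  also have "\<dots> = (\<Sum>z\<in>prod_decode ` {..<K}. ?g z)"
    by (subst sum.reindex) (auto intro: inj_on_subset[OF inj_prod_decode])
  also have "\<dots> \<le> (\<Sum>z\<in>{..<K} \<times> {..<K}. ?g z)"
  proof (intro sum_mono2 subsetI)
    fix z assume "z \<in> prod_decode ` {..<K}"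
    then obtain k where k: "k < K" "z = prod_decode k" by blast
    then have "prod_encode z = k" by simp
    then show "z \<in> {..<K} \<times> {..<K}"
      using k(1) le_prod_encode_1[of "fst z" "snd z"] le_prod_encode_2[of "snd z" "fst z"] by (cases z) auto
  qed (use w in auto)
  also have "\<dots> = (\<Sum>n<K. \<Sum>j<K. (1 / 2) ^ j * w n)" by (simp add: sum.cartesian_product)
  also have "\<dots> = (\<Sum>j<K. (1 / 2) ^ j) * (\<Sum>n<K. w n)"
    by (subst sum.swap) (simp add: sum_product)
  also have "\<dots> \<le> 2 * c"
  proof (intro mult_mono w)
    show "(\<Sum>j<K. (1 / 2 :: real) ^ j) \<le> 2"
      using sum_gp_strict[of "1 / 2 :: real" K] by simp
    show "0 \<le> (\<Sum>n<K. w n)" by (intro sum_nonneg w)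
  qed simp
  finally show ?thesis .
qed

text \<open>\<open>72\<close> is twice the \<open>36\<close> of \<open>sum_tent_diff_le\<close>;
  \<open>32\<close> is four for isolating one block times eight for the fraction of the distance
  that survives in it.\<close>

lemma almost_Lipschitz_gluing:
  fixes H :: "(real \<Rightarrow> real) set"
  assumes p: "1 \<le> p" and H: "H \<subseteq> Lp_functions p" "(\<lambda>_. 0) \<in> H"
    and net: "\<And>R \<delta>. 0 < \<delta> \<Longrightarrow> \<exists>Z. finite Z \<and> Z \<subseteq> Lp_functions p \<and>
      (\<forall>x\<in>H. Lp_norm p x \<le> R \<longrightarrow> (\<exists>z\<in>Z. Lp_norm p (\<lambda>t. x t - z t) \<le> \<delta>))"
    and C: "1 \<le> C" and sys: "\<And>n. 1 \<le> n \<Longrightarrow> \<exists>e::nat \<Rightarrow> 'b::banach. lp_system p C n e"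
    and \<phi>: "continuous_on {0..} \<phi>" "\<phi> ` {0..} \<subseteq> {0..<1}" "\<phi> 0 = 0"
  shows "\<exists>F :: _ \<Rightarrow> 'b. \<forall>x\<in>H. \<forall>y\<in>H.
    \<phi> (Lp_norm p (\<lambda>t. x t - y t)) * Lp_norm p (\<lambda>t. x t - y t) \<le> 32 * norm (F x - F y) \<and>
    norm (F x - F y) \<le> 72 * C * Lp_norm p (\<lambda>t. x t - y t)"
proof -
  \<comment> \<open>Continuity at zero provides \<open>\<tau> j\<close>. The bound by
    \<open>(1 / 2) ^ j\<close> forces \<open>\<tau> j\<close> to zero, so every positive distance
    exceeds some \<open>\<tau> j\<close>; as \<open>\<phi>\<close> need not be monotone, the
    estimate covers the whole interval.\<close>
  have "\<exists>\<tau>>0. \<tau> \<le> (1 / 2) ^ j \<and> (\<forall>t. 0 \<le> t \<and> t \<le> \<tau> \<longrightarrow> \<phi> t \<le> (1 / 2) ^ Suc j)" for j :: nat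
  proof -
    have "0 < (1 / 2 :: real) ^ Suc j" by simp
    then obtain \<delta> where \<delta>: "0 < \<delta>" "\<And>t. t \<in> {0..} \<Longrightarrow> dist t 0 < \<delta> \<Longrightarrow> dist (\<phi> t) (\<phi> 0) < (1 / 2) ^ Suc j"
      using \<phi>(1)[unfolded continuous_on_iff] by (metis atLeast_iff order_refl)
    have "\<phi> t \<le> (1 / 2) ^ Suc j" if "0 \<le> t" "t \<le> min (\<delta> / 2) ((1 / 2) ^ j)" for t
      using \<delta>(2)[of t] \<delta>(1) \<phi>(3) that by (auto simp: dist_real_def)
    then show ?thesis using \<delta>(1) by (intro exI[of _ "min (\<delta> / 2) ((1 / 2) ^ j)"]) auto
  qed
  then obtain \<tau> :: "nat \<Rightarrow> real" where \<tau>: "\<And>j. 0 < \<tau> j" "\<And>j. \<tau> j \<le> (1 / 2) ^ j"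
    "\<And>j t. 0 \<le> t \<Longrightarrow> t \<le> \<tau> j \<Longrightarrow> \<phi> t \<le> (1 / 2) ^ Suc j" by metis
  \<comment> \<open>A single index \<open>k\<close> codes the pair of the scale
    \<open>\<nu> k\<close> and the accuracy level \<open>\<iota> k\<close>.\<close>
  define \<nu> where "\<nu> k = fst (prod_decode k)" for k
  define \<iota> where "\<iota> k = snd (prod_decode k)" for k
  define a :: "nat \<Rightarrow> real" where "a k = (1 / 2) ^ \<iota> k" for k
  have a: "0 < a k" for k by (simp add: a_def)
  \<comment> \<open>The radius covers the support of the tent at scale \<open>\<nu> k\<close>; the
    error \<open>\<tau> (\<iota> k) / 8\<close> will cost at most half of a quarter of the
    distance.\<close>
  define good where "good k m S \<longleftrightarrow> 1 \<le> m \<and>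
    (\<forall>x\<in>Lp_functions p. \<forall>y\<in>Lp_functions p. \<forall>a b.
      ell_norm p m (\<lambda>i. a * S x i + b * S y i) \<le> Lp_norm p (\<lambda>t. a * x t + b * y t)) \<and>
    (\<forall>x\<in>{x\<in>H. Lp_norm p x \<le> 2 ^ Suc (\<nu> k)}. \<forall>y\<in>{x\<in>H. Lp_norm p x \<le> 2 ^ Suc (\<nu> k)}. \<forall>a b. \<bar>a\<bar> \<le> 1 \<longrightarrow> \<bar>b\<bar> \<le> 1 \<longrightarrow>
      Lp_norm p (\<lambda>t. a * x t + b * y t) \<le> ell_norm p m (\<lambda>i. a * S x i + b * S y i) + \<tau> (\<iota> k) / 8)"
    for k m and S :: "(real \<Rightarrow> real) \<Rightarrow> nat \<Rightarrow> real"
  have "\<exists>m S. good k m S" for k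
  proof -
    let ?X = "{x\<in>H. Lp_norm p x \<le> 2 ^ Suc (\<nu> k)}"
    have X: "?X \<subseteq> Lp_functions p" using H by blast
    have pos: "0 < \<tau> (\<iota> k) / 8" using \<tau>(1)[of "\<iota> k"] by simp
    have "\<exists>Z. finite Z \<and> Z \<subseteq> Lp_functions p \<and> (\<forall>x\<in>?X. \<exists>z\<in>Z. Lp_norm p (\<lambda>t. x t - z t) \<le> \<delta>)" if "0 < \<delta>" for \<delta>
      using net[OF that, of "2 ^ Suc (\<nu> k)"] by blast
    from Lp_almost_isometry_on_totally_bounded[OF p X pos this]
    show ?thesis unfolding good_def by blast
  qed
  then obtain m S where good: "\<And>k. good k (m k) (S k)" by metis
  have m1: "1 \<le> m k" for k using good[of k] by (simp add: good_def)
  have contr: "ell_norm p (m k) (\<lambda>i. \<alpha> * S k x i + \<beta> * S k y i) \<le> Lp_norm p (\<lambda>t. \<alpha> * x t + \<beta> * y t)"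
    if "x \<in> Lp_functions p" "y \<in> Lp_functions p" for k x y \<alpha> \<beta>
    using good[of k] that by (simp add: good_def)
  have expand: "Lp_norm p (\<lambda>t. \<alpha> * x t + \<beta> * y t) \<le> ell_norm p (m k) (\<lambda>i. \<alpha> * S k x i + \<beta> * S k y i) + \<tau> (\<iota> k) / 8"
    if "x \<in> H" "y \<in> H" "Lp_norm p x \<le> 2 ^ Suc (\<nu> k)" "Lp_norm p y \<le> 2 ^ Suc (\<nu> k)" "\<bar>\<alpha>\<bar> \<le> 1" "\<bar>\<beta>\<bar> \<le> 1" for k x y \<alpha> \<beta>
    using good[of k] that by (simp add: good_def)
  obtain e :: "nat \<Rightarrow> nat \<Rightarrow> 'b" where e: "\<And>k. lp_system p C (m k) (e k)"
    and indep: "\<And>v N i. i < N \<Longrightarrow> norm (\<Sum>j<m i. v i j *\<^sub>R e i j) \<le> 4 * norm (\<Sum>k<N. \<Sum>j<m k. v k j *\<^sub>R e k j)"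
    using lp_system_sequence[where m = m, OF p m1 sys] by blast
  define emb where "emb k v = (\<Sum>i<m k. (a k * v i) *\<^sub>R e k i)" for k and v :: "nat \<Rightarrow> real"
  have emb_diff: "emb k v - emb k w = emb k (\<lambda>i. v i - w i)" for k v w
    unfolding emb_def by (simp add: sum_subtractf[symmetric] scaleR_left_diff_distrib[symmetric] right_diff_distrib)
  have emb_le: "norm (emb k v) \<le> C * (a k * ell_norm p (m k) v)" and emb_ge: "a k * ell_norm p (m k) v \<le> norm (emb k v)" for k v
    using e[of k, unfolded lp_system_def, rule_format, of "\<lambda>i. a k * v i"]
      ell_norm_scale[OF p m1, of k "a k" v] a[of k] unfolding emb_def by simp_all
  define T where "T x n = tent n (Lp_norm p x)" for x n
  define comp where "comp k x = emb k (\<lambda>i. T x (\<nu> k) * S k x i)" for k x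
  have comp_diff: "comp k x - comp k y = emb k (\<lambda>i. T x (\<nu> k) * S k x i + (- T y (\<nu> k)) * S k y i)" for k x y
    unfolding comp_def emb_diff by simp
  have td: "tent_diff p x y n = Lp_norm p (\<lambda>t. T x n * x t + (- T y n) * y t)" for x y n
    by (simp add: tent_diff_def T_def)
  have sumbound: "(\<Sum>k<K. C * (a k * tent_diff p x y (\<nu> k))) \<le> 72 * C * Lp_norm p (\<lambda>t. x t - y t)"
    if "x \<in> Lp_functions p" "y \<in> Lp_functions p" for x y K
  proof -
    have "(\<Sum>k<K. a k * tent_diff p x y (\<nu> k)) \<le> 2 * (36 * Lp_norm p (\<lambda>t. x t - y t))"
      unfolding a_def \<nu>_def \<iota>_def
      by (intro sum_prod_decode_le sum_tent_diff_le p that) (simp add: tent_diff_def Lp_norm_nonneg)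
    then have "C * (\<Sum>k<K. a k * tent_diff p x y (\<nu> k)) \<le> C * (2 * (36 * Lp_norm p (\<lambda>t. x t - y t)))"
      using C by (intro mult_left_mono) auto
    then show ?thesis by (simp add: sum_distrib_left)
  qed
  have diff_le: "norm (comp k x - comp k y) \<le> C * (a k * tent_diff p x y (\<nu> k))"
    if "x \<in> Lp_functions p" "y \<in> Lp_functions p" for k x y
    unfolding comp_diff td using C a[of k] less_imp_le[OF a[of k]]
    by (intro order_trans[OF emb_le] mult_left_mono contr that) auto
  have zero: "(\<lambda>_. 0) \<in> Lp_functions p" using H by blast
  have comp_le: "norm (comp k x) \<le> C * (a k * tent_diff p x (\<lambda>_. 0) (\<nu> k))" if x: "x \<in> Lp_functions p" for k x
  proof -
    \<comment> \<open>Taking \<open>x\<close> twice with second coefficient zero avoids evaluating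
      \<open>S k\<close> at the origin.\<close>
    have "ell_norm p (m k) (\<lambda>i. T x (\<nu> k) * S k x i) \<le> tent_diff p x (\<lambda>_. 0) (\<nu> k)"
      using contr[OF x x, of k "T x (\<nu> k)" 0] by (simp add: td)
    then show ?thesis
      unfolding comp_def using C less_imp_le[OF a[of k]]
      by (intro order_trans[OF emb_le] mult_left_mono) auto
  qed
  have summ: "summable (\<lambda>k. comp k x)" if x: "x \<in> Lp_functions p" for x
  proof -
    \<comment> \<open>Comparison with the origin bounds the partial sums of the norms, and
      completeness gives convergence.\<close>
    have "(\<Sum>k<K. norm (comp k x)) \<le> 72 * C * Lp_norm p (\<lambda>t. x t - 0)" for K
      by (intro order_trans[OF sum_mono sumbound] comp_le x zero)
    then have "summable (\<lambda>k. norm (comp k x))" by (intro summableI_nonneg_bounded) auto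
    then show ?thesis by (rule summable_norm_cancel)
  qed
  define F where "F x = suminf (\<lambda>k. comp k x)" for x
  have lim: "(\<lambda>K. norm (\<Sum>k<K. comp k x - comp k y)) \<longlonglongrightarrow> norm (F x - F y)"
    if "x \<in> Lp_functions p" "y \<in> Lp_functions p" for x y
    using sums_diff[OF summable_sums[OF summ[OF that(1)]] summable_sums[OF summ[OF that(2)]]]
    unfolding F_def sums_def by (rule tendsto_norm)
  have upper: "norm (F x - F y) \<le> 72 * C * Lp_norm p (\<lambda>t. x t - y t)"
    if "x \<in> Lp_functions p" "y \<in> Lp_functions p" for x y
  proof (rule LIMSEQ_le_const2[OF lim[OF that]], intro exI allI impI)
    fix K
    show "norm (\<Sum>k<K. comp k x - comp k y) \<le> 72 * C * Lp_norm p (\<lambda>t. x t - y t)"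
      by (intro order_trans[OF norm_sum] order_trans[OF sum_mono sumbound] diff_le that)
  qed
  \<comment> \<open>The factor four bounding one block by a finite sum of blocks survives the
    limit.\<close>
  have single: "norm (comp i x - comp i y) / 4 \<le> norm (F x - F y)"
    if "x \<in> Lp_functions p" "y \<in> Lp_functions p" for x y i
  proof (rule LIMSEQ_le_const[OF lim[OF that]], intro exI allI impI)
    fix K assume "Suc i \<le> K"
    then show "norm (comp i x - comp i y) / 4 \<le> norm (\<Sum>k<K. comp k x - comp k y)"
      using indep[of i K "\<lambda>k j. a k * (T x (\<nu> k) * S k x j + (- T y (\<nu> k)) * S k y j)"]
      unfolding comp_diff emb_def by simp
  qed
  have lower: "\<phi> (Lp_norm p (\<lambda>t. x t - y t)) * Lp_norm p (\<lambda>t. x t - y t) \<le> 32 * norm (F x - F y)"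
    if x: "x \<in> H" and y: "y \<in> H" for x y
  proof -
    let ?d = "Lp_norm p (\<lambda>t. x t - y t)"
    have xy: "x \<in> Lp_functions p" "y \<in> Lp_functions p" using x y H by auto
    have T1: "\<bar>T z n\<bar> \<le> 1" for z n using tent_bounds[OF Lp_norm_nonneg[of p z], of n] by (simp add: T_def)
    show ?thesis
    proof (cases "?d = 0")
      case False
      then have d: "0 < ?d" using Lp_norm_nonneg[of p] by (simp add: less_le)
      have "(\<lambda>j. (1 / 2 :: real) ^ j) \<longlonglongrightarrow> 0" by (rule LIMSEQ_realpow_zero) auto
      then have "\<forall>\<^sub>F j in sequentially. (1 / 2) ^ j < ?d" using d by (rule order_tendstoD)
      then obtain j0 where "(1 / 2) ^ j0 < ?d" by (auto simp: eventually_sequentially)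
      then have ex: "\<tau> j0 \<le> ?d" using \<tau>(2)[of j0] by linarith
      \<comment> \<open>The first level whose \<open>\<tau>\<close> does not exceed the distance. At
        the previous level \<open>?d\<close> lies below \<open>\<tau>\<close>, which gives the bound
        on \<open>\<phi> ?d\<close>; for \<open>j = 0\<close> the bound is
        \<open>\<phi> < 1\<close>.\<close>
      define j where "j = (LEAST j. \<tau> j \<le> ?d)"
      have j: "\<tau> j \<le> ?d" unfolding j_def using ex by (rule LeastI)
      have \<phi>j: "\<phi> ?d \<le> (1 / 2) ^ j"
      proof (cases j)
        case 0
        have "\<phi> ?d \<in> {0..<1}" using subsetD[OF \<phi>(2) imageI, of ?d] d by simp
        then show ?thesis using 0 by simp
      next
        case (Suc i)
        then have "\<not> \<tau> i \<le> ?d" using not_less_Least[of i "\<lambda>j. \<tau> j \<le> ?d"] by (simp add: j_def)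
        then show ?thesis using \<tau>(3)[of ?d i] d Suc by simp
      qed
      obtain n where n: "?d / 4 \<le> tent_diff p x y n" using tent_diff_large[OF p xy] by blast
      define k where "k = prod_encode (n, j)"
      have k: "\<nu> k = n" "\<iota> k = j" "a k = (1 / 2) ^ j" by (auto simp: k_def \<nu>_def \<iota>_def a_def)
      \<comment> \<open>\<open>expand\<close> needs points of norm at most \<open>2 ^ Suc n\<close>.
        A point of weight zero may lie outside that ball; replacing it by the origin changes none of
        the weighted terms.\<close>
      define x' where "x' = (if T x n = 0 then (\<lambda>_. 0) else x)"
      define y' where "y' = (if T y n = 0 then (\<lambda>_. 0) else y)"
      have small: "Lp_norm p (\<lambda>_. 0) \<le> 2 ^ Suc n"
        using Lp_norm_eq_0_iff[OF p zero] by simp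
      have x': "x' \<in> H" "Lp_norm p x' \<le> 2 ^ Suc n" "\<And>t. T x n * x' t = T x n * x t" "\<And>i. T x n * S k x' i = T x n * S k x i"
        using x H small tent_nonzero_less[of n "Lp_norm p x"] by (auto simp: x'_def T_def)
      have y': "y' \<in> H" "Lp_norm p y' \<le> 2 ^ Suc n" "\<And>t. T y n * y' t = T y n * y t" "\<And>i. T y n * S k y' i = T y n * S k y i"
        using y H small tent_nonzero_less[of n "Lp_norm p y"] by (auto simp: y'_def T_def)
      have "tent_diff p x y n \<le> ell_norm p (m k) (\<lambda>i. T x n * S k x i + (- T y n) * S k y i) + \<tau> j / 8"
        using expand[of x' y' k "T x n" "- T y n"] x' y' T1 by (simp add: k td)
      \<comment> \<open>Since \<open>\<tau> j \<le> ?d\<close>, at least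
        \<open>?d / 4 - ?d / 8\<close> remains.\<close>
      then have "?d / 8 \<le> ell_norm p (m k) (\<lambda>i. T x n * S k x i + (- T y n) * S k y i)"
        using n j by linarith
      then have "a k * (?d / 8) \<le> a k * ell_norm p (m k) (\<lambda>i. T x n * S k x i + (- T y n) * S k y i)"
        using less_imp_le[OF a[of k]] by (rule mult_left_mono)
      also have "\<dots> \<le> norm (comp k x - comp k y)" unfolding comp_diff k(1) by (rule emb_ge)
      also have "\<dots> \<le> 4 * norm (F x - F y)" using single[OF xy, of k] by simp
      finally have "(1 / 2) ^ j * ?d \<le> 32 * norm (F x - F y)" using k(3) by simp
      moreover have "\<phi> ?d * ?d \<le> (1 / 2) ^ j * ?d" using \<phi>j d by (intro mult_right_mono) auto
      ultimately show ?thesis by linarith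
    qed simp
  qed
  show ?thesis using upper lower H by (intro exI[of _ F]) blast
qed

section \<open>Embedding of a proper subset of \<open>L_p\<close>\<close>

theorem corollary2:
  fixes p :: ennreal and M :: "(real \<Rightarrow> real) set set"
  assumes "1 \<le> p"
    and "M \<subseteq> mspace (Lp_metric p)"
    and "proper_metric (submetric (Lp_metric p) M)"
    and "contains_lp_uniformly p (UNIV :: 'b::banach set)"
  shows "almost_Lipschitz_embeddable (submetric (Lp_metric p) M) (euclidean_metric :: 'b metric)"
proof -
  note p = assms(1)
  let ?X = "submetric (Lp_metric p) M"
  have X: "mspace ?X = M" "mdist ?X = Lp_dist p"
    using assms(2) by (auto simp: mdist_Lp[OF p])
  interpret Metric_space M "Lp_dist p"
    using Metric_space_mspace_mdist[of ?X] unfolding X .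
  obtain C where C: "1 \<le> C" and sys: "\<And>n. 1 \<le> n \<Longrightarrow> \<exists>e::nat \<Rightarrow> 'b. lp_system p C n e"
    using contains_lp_uniformly_imp_lp_system[OF p assms(4)] by blast
  \<comment> \<open>The same choice of representatives as in \<open>Lp_dist\<close>, so norms of
    differences of representatives are distances by definition.\<close>
  define rep :: "(real \<Rightarrow> real) set \<Rightarrow> real \<Rightarrow> real" where "rep F = (SOME f. f \<in> F)" for F
  have repL: "rep F \<in> Lp_functions p" if "F \<in> M" for F
  proof -
    from that assms(2) obtain f where f: "f \<in> Lp_functions p" "F = Lp_class p f"
      unfolding mspace_Lp[OF p] by blast
    then have "f \<in> F" by (simp add: Lp_class_def)
    then have "rep F \<in> F" unfolding rep_def by (rule someI[of "\<lambda>f. f \<in> F"])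
    then show ?thesis using f by (simp add: Lp_class_def)
  qed
  show ?thesis
  proof (cases "M = {}")
    \<comment> \<open>An empty set offers no base point for the translation; any constants
      serve.\<close>
    case True
    show ?thesis
      unfolding almost_Lipschitz_embeddable_def X True by (rule exI[of _ 1], rule conjI, simp, rule exI[of _ 1]) simp
  next
    case False
    then obtain c where c: "c \<in> M" by blast
    \<comment> \<open>Translation by a base point brings the origin into the set, as the gluing
      requires.\<close>
    define h where "h F = (\<lambda>t. rep F t - rep c t)" for F
    have hL: "h F \<in> Lp_functions p" if "F \<in> M" for F
      unfolding h_def by (intro Lp_diff p repL that c)
    have hd: "Lp_norm p (\<lambda>t. h F t - h G t) = Lp_dist p F G" for F G
      by (simp add: h_def Lp_dist_def rep_def)
    have hn: "Lp_norm p (h F) = Lp_dist p F c" for F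
      by (simp add: h_def Lp_dist_def rep_def)
    have h0: "(\<lambda>_. 0) \<in> h ` M" using c by (auto simp: h_def intro!: image_eqI[of _ _ c])
    have net: "\<exists>Z. finite Z \<and> Z \<subseteq> Lp_functions p \<and>
      (\<forall>x\<in>h ` M. Lp_norm p x \<le> R \<longrightarrow> (\<exists>z\<in>Z. Lp_norm p (\<lambda>t. x t - z t) \<le> \<delta>))" if \<delta>: "0 < \<delta>" for R \<delta>
    proof -
      \<comment> \<open>Compact balls about the base point are totally bounded; translated to the
        origin they give the nets.\<close>
      have "compactin mtopology (mcball c R)"
        using bspec[OF assms(3)[unfolded proper_metric_def mtopology_of_def mcball_of_def X] c] by (rule spec)
      then have "mtotally_bounded (mcball c R)" by (rule compactin_imp_mtotally_bounded)
      then have "\<exists>K. finite K \<and> K \<subseteq> mcball c R \<and> mcball c R \<subseteq> (\<Union>x\<in>K. mball x \<delta>)"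
        using \<delta> unfolding mtotally_bounded_def by simp
      then obtain K where K: "finite K" "K \<subseteq> mcball c R" "mcball c R \<subseteq> (\<Union>x\<in>K. mball x \<delta>)"
        by (elim exE conjE)
      have "\<exists>z\<in>h ` K. Lp_norm p (\<lambda>t. h F t - z t) \<le> \<delta>" if F: "F \<in> M" "Lp_norm p (h F) \<le> R" for F
      proof -
        have "F \<in> mcball c R" using F c by (simp add: hn commute)
        then have "F \<in> (\<Union>x\<in>K. mball x \<delta>)" by (rule subsetD[OF K(3)])
        then obtain G where "G \<in> K" "F \<in> mball G \<delta>" by (rule UN_E)
        then show ?thesis by (intro bexI[of _ "h G"]) (auto simp: hd commute)
      qed
      moreover have "h ` K \<subseteq> Lp_functions p" using K(2) hL by (auto simp: subset_iff)
      ultimately show ?thesis using K(1) by (intro exI[of _ "h ` K"]) auto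
    qed
    have sub: "h ` M \<subseteq> Lp_functions p" using hL by blast
    \<comment> \<open>Dividing the lower estimate by \<open>32\<close> gives
      \<open>r = 1 / 32\<close>, hence \<open>D = 32 * 72 * C\<close>; both are fixed before
      \<open>\<phi>\<close> is introduced.\<close>
    show ?thesis
      unfolding almost_Lipschitz_embeddable_def X
    proof (rule exI[of _ "1 / 32"], rule conjI, simp, rule exI[of _ "2304 * C"], intro conjI allI impI)
      fix \<phi> :: "real \<Rightarrow> real"
      assume "continuous_on {0..} \<phi> \<and> \<phi> ` {0..} \<subseteq> {0..<1} \<and> \<phi> 0 = 0 \<and> (\<forall>t>0. 0 < \<phi> t)"
      then have \<phi>: "continuous_on {0..} \<phi>" "\<phi> ` {0..} \<subseteq> {0..<1}" "\<phi> 0 = 0" by simp_all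
      from almost_Lipschitz_gluing[OF p sub h0 net C sys \<phi>] obtain F :: "_ \<Rightarrow> 'b" where F: "\<forall>x\<in>h ` M. \<forall>y\<in>h ` M.
        \<phi> (Lp_norm p (\<lambda>t. x t - y t)) * Lp_norm p (\<lambda>t. x t - y t) \<le> 32 * norm (F x - F y) \<and>
        norm (F x - F y) \<le> 72 * C * Lp_norm p (\<lambda>t. x t - y t)" by (rule exE)
      have "\<phi> (Lp_dist p G G') * (1 / 32) * Lp_dist p G G' \<le> mdist euclidean_metric (F (h G)) (F (h G')) \<and>
          mdist euclidean_metric (F (h G)) (F (h G')) \<le> 2304 * C * (1 / 32) * Lp_dist p G G'"
        if "G \<in> M" "G' \<in> M" for G G'
        using bspec[OF bspec[OF F imageI[OF that(1)]] imageI[OF that(2)]] by (simp add: hd dist_norm)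
      then show "\<exists>f. f ` M \<subseteq> mspace (euclidean_metric :: 'b metric) \<and> (\<forall>x\<in>M. \<forall>y\<in>M.
          \<phi> (Lp_dist p x y) * (1 / 32) * Lp_dist p x y \<le> mdist euclidean_metric (f x) (f y) \<and>
          mdist euclidean_metric (f x) (f y) \<le> 2304 * C * (1 / 32) * Lp_dist p x y)"
        by (intro exI[of _ "\<lambda>G. F (h G)"]) simp
    qed (use C in auto)
  qed
qed

end
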